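(* Let $d\in\mathbb{N}$, $L,T\in(0,\infty)$, let $\|\cdot\|\colon\mathbb{R}^d\to[0,\infty)$ be a norm on $\mathbb{R}^d$, let $\mathcal{O}\subseteq\mathbb{R}^d$ be a non-empty open set, and for every $r\in(0,\infty)$ let $O_r=\{x\in\mathcal{O}\colon\|x\|\le r\text{ and }\{y\in\mathbb{R}^d\colon\|y-x\|<1/r\}\subseteq\mathcal{O}\}$. Let $(\Omega,\mathcal{F},\mathbb{P})$ be a probability space, and for every $t\in[0,T]$, $x\in\mathcal{O}$ let $X^{t,x}=(X^{t,x}_s)_{s\in[t,T]}\colon[t,T]\times\Omega\to\mathcal{O}$ be $(\mathcal{B}([t,T])\otimes\mathcal{F})/\mathcal{B}(\mathcal{O})$-measurable. Assume for all $\varepsilon\in(0,\infty)$, $s\in[0,T]$ and all $(t_n,x_n)\in[0,T]\times\mathcal{O}$, $n\in\mathbb{N}_0$, with $\limsup_{n\to\infty}[|t_n-t_0|+\|x_n-x_0\|]=0$ that $$\limsup_{n\to\infty}\big[\mathbb{P}\big(\|X^{t_n,x_n}_{\max\{s,t_n\}}-X^{t_0,x_0}_{\max\{s,t_0\}}\|\ge\varepsilon\big)\big]=0.$$ Let $f\in C([0,T]\times\mathcal{O}\times\mathbb{R},\mathbb{R})$, $g\in C(\mathcal{O},\mathbb{R})$, $V\in C([0,T]\times\mathcal{O},(0,\infty))$ satisfy for all $t\in[0,T]$, $s\in[t,T]$, $x\in\mathcal{O}$, $v,w\in\mathbb{R}$ that $\mathbb{E}[V(s,X^{t,x}_s)]\le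 V(t,x)$ and $|f(t,x,v)-f(t,x,w)|\le L|v-w|$, and assume that $$\inf_{r\in(0,\infty)}\left[\sup_{t\in[0,T]}\sup_{x\in\mathcal{O}\setminus O_r}\left(\frac{|f(t,x,0)|}{V(t,x)}+\frac{|g(x)|}{V(T,x)}\right)\right]=0\quad\text{and}\quad\sup_{r\in(0,\infty)}\left[\inf_{t\in[0,T]}\inf_{x\in\mathcal{O}\setminus O_r}V(t,x)\right]=\infty.$$ Then there exists a unique $u\in C([0,T]\times\mathcal{O},\mathbb{R})$ such that (i) it holds that $\limsup_{r\to\infty}\left[\sup_{t\in[0,T]}\sup_{x\in\mathcal{O}\setminus O_r}\left(\frac{|u(t,x)|}{V(t,x)}\right)\right]=0$ and (ii) it holds for all $t\in[0,T]$, $x\in\mathcal{O}$ that $$u(t,x)=\mathbb{E}\left[g(X^{t,x}_T)+\int_t^T f\big(s,X^{t,x}_s,u(s,X^{t,x}_s)\big)\,ds\right].$$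
   Context: $\mathcal{B}(S)$ denotes the Borel $\sigma$-algebra of a topological space $S$, and "$\mathcal{A}/\mathcal{B}$-measurable" means measurable from the $\sigma$-algebra $\mathcal{A}$ to the $\sigma$-algebra $\mathcal{B}$. $C(A,B)$ denotes the set of continuous functions from $A$ to $B$. $\mathbb{N}_0=\mathbb{N}\cup\{0\}$. *)

theory Defs
  imports "HOL-Probability.Probability"
begin

definition is_norm :: "('a::real_vector \<Rightarrow> real) \<Rightarrow> bool" where
  "is_norm N \<longleftrightarrow>
     (\<forall>x. 0 \<le> N x) \<and>
     (\<forall>x. N x = 0 \<longleftrightarrow> x = 0) \<and>
     (\<forall>a x. N (a *\<^sub>R x) = \<bar>a\<bar> * N x) \<and>
     (\<forall>x y. N (x + y) \<le> N x + N y)"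

definition inner_part :: "('a::real_vector \<Rightarrow> real) \<Rightarrow> 'a set \<Rightarrow> real \<Rightarrow> 'a set" where
  "inner_part N S r = {x \<in> S. N x \<le> r \<and> {y. N (y - x) < 1 / r} \<subseteq> S}"

text \<open>
  The stochastic fixed point equation
  \<open>u(t,x) = E[g(X\<^sup>t\<^sup>,\<^sup>x\<^sub>T) + \<integral>\<^sub>t\<^sup>T f(s, X\<^sup>t\<^sup>,\<^sup>x\<^sub>s, u(s, X\<^sup>t\<^sup>,\<^sup>x\<^sub>s)) ds]\<close>,
  where \<open>X t x s \<omega>\<close> stands for the value of the process started from \<open>(t, x)\<close> at time \<open>s\<close>.
  Library integrals take the value 0 where the integrand is not integrable. The first two
  conjuncts therefore state that both integrals exist: the time integral almost surely, and the
  expectation as a finite one.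
\<close>

definition solves_sfpe ::
  "'w measure \<Rightarrow> real \<Rightarrow> 'a set \<Rightarrow> (real \<Rightarrow> 'a \<Rightarrow> real \<Rightarrow> 'w \<Rightarrow> 'a)
    \<Rightarrow> (real \<times> 'a \<times> real \<Rightarrow> real) \<Rightarrow> ('a \<Rightarrow> real) \<Rightarrow> (real \<times> 'a \<Rightarrow> real) \<Rightarrow> bool" where
  "solves_sfpe M T S X f g u \<longleftrightarrow>
     (\<forall>t\<in>{0..T}. \<forall>x\<in>S.
        (AE \<omega> in M. set_integrable lborel {t..T} (\<lambda>s. f (s, X t x s \<omega>, u (s, X t x s \<omega>)))) \<and>
        integrable M (\<lambda>\<omega>. g (X t x T \<omega>)
          + (LBINT s:{t..T}. f (s, X t x s \<omega>, u (s, X t x s \<omega>)))) \<and>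
        u (t, x) = (LINT \<omega>|M. g (X t x T \<omega>)
          + (LBINT s:{t..T}. f (s, X t x s \<omega>, u (s, X t x s \<omega>)))))"

end

theory Submission
  imports Defs
begin

text \<open>
  The right-hand side of the equation defines a map \<open>\<Phi>\<close> on functions \<open>u\<close> (below: \<open>picard\<close>), and
  the theorem is a fixed point theorem for \<open>\<Phi>\<close> in the space of continuous functions that are of
  smaller order than \<open>V\<close> near the ideal boundary of \<open>\<O>\<close>.

  The contraction comes from the supermartingale inequality: if
  \<open>\<bar>u - v\<bar> \<le> A e\<^sup>-\<^sup>2\<^sup>L\<^sup>t V\<close>, then the Lipschitz condition and \<open>E V(s, X\<^sup>t\<^sup>,\<^sup>x\<^sub>s) \<le> V(t, x)\<close> give
  \<open>\<bar>\<Phi> u - \<Phi> v\<bar>(t, x) \<le> L A V(t, x) \<integral>\<^sub>t\<^sup>T e\<^sup>-\<^sup>2\<^sup>L\<^sup>s ds \<le> (A / 2) e\<^sup>-\<^sup>2\<^sup>L\<^sup>t V(t, x)\<close>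
  (\<open>picard_contraction\<close>). Hence the Picard iterates converge uniformly relative to \<open>V\<close>, and two
  solutions coincide.

  It remains to see that \<open>\<Phi>\<close> preserves the space. Since \<open>V\<close> tends to infinity off the compact
  subsets of \<open>\<O>\<close>, a continuous \<open>h\<close> satisfies \<open>h / V \<longrightarrow> 0\<close> there if and only if for every \<open>\<epsilon> > 0\<close>
  it obeys a global bound \<open>\<bar>h\<bar> \<le> C + \<epsilon> V\<close> (\<open>sublinear_iff_vanishing\<close>). The supermartingale
  inequality carries this second form over from \<open>h\<close> to \<open>(t, x) \<mapsto> E h(s, X\<^sup>t\<^sup>,\<^sup>x\<^sub>s)\<close> with the same
  constants. It also yields continuity of that expectation: truncating \<open>h\<close> at the level \<open>C\<close> changes
  it by at most \<open>\<epsilon> V\<close>, and for bounded continuous functions convergence in probability of the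
  processes suffices (\<open>tendsto_expectation\<close>). A Fubini argument and dominated convergence then treat
  the time integral.
\<close>

section \<open>Norms and exhaustion by inner parts\<close>

lemma is_norm_upper_bound:
  fixes N :: "'a::euclidean_space \<Rightarrow> real"
  assumes "is_norm N"
  obtains C where "0 < C" "\<And>x. N x \<le> C * norm x"
proof -
  have nonneg: "\<And>x. 0 \<le> N x" and zero: "\<And>x. N x = 0 \<longleftrightarrow> x = 0"
    and scale: "\<And>a x. N (a *\<^sub>R x) = \<bar>a\<bar> * N x" and triangle: "\<And>x y. N (x + y) \<le> N x + N y"
    using assms unfolding is_norm_def by blast+
  define C where "C = (\<Sum>b\<in>Basis. N b) + 1"
  have C_pos: "0 < C"
    unfolding C_def by (simp add: add_nonneg_pos nonneg sum_nonneg)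
  have sum_le: "N (sum h I) \<le> (\<Sum>i\<in>I. N (h i))" if "finite I" for I and h :: "'a \<Rightarrow> 'a"
    using that
  proof (induction I)
    case empty
    show ?case using zero[of 0] by simp
  next
    case (insert i I)
    then show ?case using triangle[of "h i" "sum h I"] by simp
  qed
  have "N x \<le> C * norm x" for x
  proof -
    have "N x = N (\<Sum>b\<in>Basis. (x \<bullet> b) *\<^sub>R b)"
      by (simp add: euclidean_representation)
    also have "\<dots> \<le> (\<Sum>b\<in>Basis. \<bar>x \<bullet> b\<bar> * N b)"
      using sum_le[OF finite_Basis, of "\<lambda>b. (x \<bullet> b) *\<^sub>R b"] by (simp add: scale)
    also have "\<dots> \<le> (\<Sum>b\<in>Basis. norm x * N b)"
      by (intro sum_mono mult_right_mono) (auto simp: Basis_le_norm nonneg)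
    also have "\<dots> \<le> C * norm x"
      unfolding C_def sum_distrib_left[symmetric] by (simp add: algebra_simps)
    finally show ?thesis .
  qed
  with C_pos show thesis by (rule that)
qed

lemma is_norm_continuous_on:
  fixes N :: "'a::euclidean_space \<Rightarrow> real"
  assumes "is_norm N"
  shows "continuous_on A N"
proof -
  obtain C where C: "0 < C" "\<And>x. N x \<le> C * norm x"
    using is_norm_upper_bound[OF assms] by metis
  have "\<bar>N x - N y\<bar> \<le> N (x - y)" for x y
  proof -
    have triangle: "\<And>x y. N (x + y) \<le> N x + N y" and "\<And>x. N (- 1 *\<^sub>R x) = \<bar>- 1\<bar> * N x"
      using assms unfolding is_norm_def by blast+
    then have "N (y - x) = N (x - y)" by (metis abs_neg_one minus_diff_eq mult_1 scaleR_minus1_left)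
    then show ?thesis
      using triangle[of "x - y" y] triangle[of "y - x" x] by simp
  qed
  then have "C-lipschitz_on UNIV N"
    by (intro lipschitz_onI) (use C in \<open>auto simp: dist_norm intro: order_trans\<close>)
  then show ?thesis
    using lipschitz_on_continuous_on continuous_on_subset by blast
qed

text \<open>
  A continuous function attains its infimum on the unit sphere, and there \<open>N\<close> does not vanish.
\<close>

lemma is_norm_lower_bound:
  fixes N :: "'a::euclidean_space \<Rightarrow> real"
  assumes "is_norm N"
  obtains c where "0 < c" "\<And>x. c * norm x \<le> N x"
proof -
  have nonneg: "\<And>x. 0 \<le> N x" and zero: "\<And>x. N x = 0 \<longleftrightarrow> x = 0"
    and scale: "\<And>a x. N (a *\<^sub>R x) = \<bar>a\<bar> * N x"
    using assms unfolding is_norm_def by blast+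
  have "(SOME b. b \<in> (Basis::'a set)) \<in> sphere 0 1"
    by (simp add: some_in_eq)
  then have "sphere (0::'a) 1 \<noteq> {}" by blast
  from continuous_attains_inf[OF compact_sphere this is_norm_continuous_on[OF assms]]
  obtain z where z: "norm z = 1" and min: "\<And>y. norm y = 1 \<Longrightarrow> N z \<le> N y"
    by auto
  have "N z * norm x \<le> N x" for x
  proof (cases "x = 0")
    case False
    then have "N z \<le> N ((1 / norm x) *\<^sub>R x)" by (intro min) simp
    with False show ?thesis by (simp add: scale field_simps)
  qed (simp add: nonneg)
  moreover have "0 < N z" using nonneg[of z] zero[of z] z by fastforce
  ultimately show thesis using that by blast
qed

text \<open>
  Positivity of \<open>r\<close> matters for closedness: a limit \<open>w\<close> of points of the set satisfies the ball
  condition, and it lies in \<open>S\<close> because it belongs to its own ball of radius \<open>1 / r\<close>.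
\<close>

lemma compact_inner_part:
  fixes N :: "'a::euclidean_space \<Rightarrow> real"
  assumes "is_norm N" "0 < r"
  shows "compact (inner_part N S r)"
  unfolding compact_eq_bounded_closed
proof
  obtain c where c: "0 < c" "\<And>x. c * norm x \<le> N x"
    using is_norm_lower_bound[OF assms(1)] by metis
  show "bounded (inner_part N S r)"
  proof (rule boundedI)
    fix x assume "x \<in> inner_part N S r"
    then have "c * norm x \<le> r" using c(2)[of x] by (auto simp: inner_part_def)
    then show "norm x \<le> r / c" using c(1) by (simp add: field_simps)
  qed
  have N0: "N 0 = 0"
    using assms(1) unfolding is_norm_def by blast
  have tendsto_N: "(\<lambda>n. N (z n)) \<longlonglongrightarrow> N w" if "z \<longlonglongrightarrow> w" for z w
    using is_norm_continuous_on[OF assms(1), of UNIV] that continuous_on_tendsto_compose[of UNIV N z w]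
    by auto
  show "closed (inner_part N S r)"
    unfolding closed_sequential_limits
  proof (intro allI impI, elim conjE)
    fix z w assume z: "\<forall>n. z n \<in> inner_part N S r" and lim: "z \<longlonglongrightarrow> w"
    have "N w \<le> r"
      using z by (intro LIMSEQ_le_const2[OF tendsto_N[OF lim]]) (auto simp: inner_part_def)
    moreover have ball: "y \<in> S" if "N (y - w) < 1 / r" for y
    proof -
      have "(\<lambda>n. N (y - z n)) \<longlonglongrightarrow> N (y - w)"
        by (intro tendsto_N tendsto_intros lim)
      then have "eventually (\<lambda>n. N (y - z n) < 1 / r) sequentially"
        using that by (rule order_tendstoD)
      then obtain n where "N (y - z n) < 1 / r"
        by (auto simp: eventually_sequentially)
      with z show ?thesis by (auto simp: inner_part_def)
    qed
    moreover have "w \<in> S"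
      using assms by (intro ball) (simp add: N0)
    ultimately show "w \<in> inner_part N S r"
      by (auto simp: inner_part_def)
  qed
qed

text \<open>
  A compact subset of \<open>S\<close> is bounded and keeps a positive distance from the complement of \<open>S\<close>.
  The sets \<open>inner_part N S r\<close> can therefore be replaced by arbitrary compact subsets of \<open>S\<close> in
  statements about limits.
\<close>

lemma inner_part_exhausts:
  fixes N :: "'a::euclidean_space \<Rightarrow> real"
  assumes "is_norm N" "open S" "compact K" "K \<subseteq> S"
  shows "eventually (\<lambda>r. K \<subseteq> inner_part N S r) at_top"
proof -
  obtain c where c: "0 < c" "\<And>x. c * norm x \<le> N x"
    using is_norm_lower_bound[OF assms(1)] by metis
  obtain e where e: "0 < e" "(\<Union>x\<in>K. ball x e) \<subseteq> S"
    using compact_subset_open_imp_ball_epsilon_subset[OF assms(3,2,4)] by blast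
  have "bounded (N ` K)"
    by (intro compact_imp_bounded compact_continuous_image is_norm_continuous_on assms)
  then obtain B where B: "\<And>x. x \<in> K \<Longrightarrow> \<bar>N x\<bar> \<le> B"
    by (auto simp: bounded_iff)
  show ?thesis
    using eventually_ge_at_top[of B] eventually_ge_at_top[of "1 / (c * e)"] eventually_gt_at_top[of 0]
  proof eventually_elim
    case (elim r)
    show ?case
    proof
      fix x assume x: "x \<in> K"
      have "y \<in> S" if y: "N (y - x) < 1 / r" for y
      proof -
        have "1 / r \<le> c * e" using elim c(1) e(1) by (simp add: field_simps)
        then have "c * norm (y - x) < c * e" using y c(2)[of "y - x"] by linarith
        then have "y \<in> ball x e" using c(1) by (simp add: dist_norm norm_minus_commute)
        with e(2) x show ?thesis by blast
      qed
      with x B[OF x] elim assms(4) show "x \<in> inner_part N S r"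
        by (auto simp: inner_part_def)
    qed
  qed
qed

text \<open>
  A nonempty open set that equals a compact one would be clopen, hence the whole space. This
  guarantees that the suprema over complements of compacts are not suprema of the empty set.
\<close>

lemma open_Diff_compact_nonempty:
  fixes S :: "'a::euclidean_space set"
  assumes "open S" "S \<noteq> {}" "compact K" "K \<subseteq> S"
  shows "S - K \<noteq> {}"
proof
  assume "S - K = {}"
  with assms have "compact S" by (metis Diff_eq_empty_iff subset_antisym)
  with assms have "S = UNIV" using clopen[of S] compact_imp_closed by blast
  with \<open>compact S\<close> show False using not_bounded_UNIV compact_imp_bounded by metis
qed

lemma bounded_off_compact:
  fixes h V :: "'b::topological_space \<times> 'a::topological_space \<Rightarrow> real"
  assumes "compact A" "compact K" "K \<subseteq> S" and h: "continuous_on (A \<times> S) h"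
    and "0 \<le> e" and V: "\<And>t x. t \<in> A \<Longrightarrow> x \<in> S \<Longrightarrow> 0 \<le> V (t, x)"
    and off: "\<And>t x. t \<in> A \<Longrightarrow> x \<in> S - K \<Longrightarrow> \<bar>h (t, x)\<bar> \<le> e * V (t, x)"
  shows "\<exists>C\<ge>0. \<forall>t\<in>A. \<forall>x\<in>S. \<bar>h (t, x)\<bar> \<le> C + e * V (t, x)"
proof -
  have "continuous_on (A \<times> K) h"
    using h by (rule continuous_on_subset) (use \<open>K \<subseteq> S\<close> in auto)
  then have "bounded (h ` (A \<times> K))"
    by (intro compact_imp_bounded compact_continuous_image compact_Times assms)
  then obtain C where C: "\<And>p. p \<in> A \<times> K \<Longrightarrow> \<bar>h p\<bar> \<le> C"
    by (auto simp: bounded_iff)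
  have "\<bar>h (t, x)\<bar> \<le> max 0 C + e * V (t, x)" if tx: "t \<in> A" "x \<in> S" for t x
  proof -
    have "0 \<le> e * V (t, x)" using V[OF tx] \<open>0 \<le> e\<close> by simp
    then show ?thesis
      using C[of "(t, x)"] off[of t x] tx by (cases "x \<in> K") force+
  qed
  then show ?thesis by (intro exI[of _ "max 0 C"]) auto
qed

text \<open>
  Off the compact set the bound is \<open>1\<close>, and on it a positive continuous function has a positive
  minimum. A positive lower bound for \<open>V\<close> lets constants be absorbed into multiples of \<open>V\<close>.
\<close>

lemma coercive_imp_bounded_below:
  fixes V :: "'b::topological_space \<times> 'a::topological_space \<Rightarrow> real"
  assumes "compact A" and V: "continuous_on (A \<times> S) V"
    and pos: "\<And>t x. t \<in> A \<Longrightarrow> x \<in> S \<Longrightarrow> 0 < V (t, x)"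
    and K: "compact K" "K \<subseteq> S" and off: "\<And>t x. t \<in> A \<Longrightarrow> x \<in> S - K \<Longrightarrow> 1 \<le> V (t, x)"
  obtains \<delta> where "0 < \<delta>" "\<And>t x. t \<in> A \<Longrightarrow> x \<in> S \<Longrightarrow> \<delta> \<le> V (t, x)"
proof -
  have "\<exists>\<delta>>0. \<forall>p\<in>A \<times> K. \<delta> \<le> V p"
  proof (cases "A \<times> K = {}")
    case False
    have "compact (A \<times> K)" "continuous_on (A \<times> K) V"
      using assms by (auto intro: compact_Times continuous_on_subset[OF V])
    from continuous_attains_inf[OF this(1) False this(2)]
    obtain p where "p \<in> A \<times> K" "\<forall>q\<in>A \<times> K. V p \<le> V q" by blast
    moreover have "0 < V p" using \<open>p \<in> A \<times> K\<close> K(2) pos by auto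
    ultimately show ?thesis by blast
  qed (auto intro: exI[of _ 1])
  then obtain \<delta> where \<delta>: "0 < \<delta>" "\<And>p. p \<in> A \<times> K \<Longrightarrow> \<delta> \<le> V p" by blast
  show thesis
  proof (rule that[of "min \<delta> 1"])
    fix t x assume "t \<in> A" "x \<in> S"
    then show "min \<delta> 1 \<le> V (t, x)"
      using \<delta>(2)[of "(t, x)"] off[of t x] by (cases "x \<in> K") auto
  qed (use \<delta>(1) in simp)
qed

text \<open>
  Boundary condition (i) in elementary terms. In the extended reals the supremum of the empty set is
  \<open>-\<infinity>\<close>, so the inequality \<open>0 \<le> Limsup\<close> needs that no inner part exhausts \<open>S\<close>.
\<close>

lemma Limsup_inner_part_eq_0_iff:
  fixes N :: "'a::euclidean_space \<Rightarrow> real" and u V :: "real \<times> 'a \<Rightarrow> real"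
  assumes N: "is_norm N" and S: "open S" "S \<noteq> {}" and T: "0 \<le> T"
    and V: "\<And>t x. t \<in> {0..T} \<Longrightarrow> x \<in> S \<Longrightarrow> 0 < V (t, x)"
  shows "Limsup at_top (\<lambda>r::real. SUP t\<in>{0..T}. SUP x\<in>S - inner_part N S r.
      ereal (\<bar>u (t, x)\<bar> / V (t, x))) = 0 \<longleftrightarrow>
    (\<forall>e>0. \<exists>K. compact K \<and> K \<subseteq> S \<and> (\<forall>t\<in>{0..T}. \<forall>x\<in>S - K. \<bar>u (t, x)\<bar> \<le> e * V (t, x)))"
    (is "Limsup at_top ?F = 0 \<longleftrightarrow> ?vanish")
proof
  have sub: "inner_part N S r \<subseteq> S" for r by (auto simp: inner_part_def)
  have le_iff: "(SUP t\<in>{0..T}. SUP x\<in>S - K. ereal (\<bar>u (t, x)\<bar> / V (t, x))) \<le> ereal e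
      \<longleftrightarrow> (\<forall>t\<in>{0..T}. \<forall>x\<in>S - K. \<bar>u (t, x)\<bar> \<le> e * V (t, x))" for K e
    using V by (simp add: SUP_le_iff divide_le_eq)
  {
    assume L: "Limsup at_top ?F = 0"
    show ?vanish
    proof (intro allI impI)
      fix e :: real assume "0 < e"
      then have "eventually (\<lambda>r. ?F r < ereal e) at_top"
        using L by (intro Limsup_lessD) simp
      then have "eventually (\<lambda>r. ?F r < ereal e \<and> 0 < r) at_top"
        using eventually_gt_at_top[of 0] by (rule eventually_conj)
      then obtain r where r: "0 < r" "?F r \<le> ereal e"
        by (auto simp: eventually_at_top_linorder less_imp_le)
      from r(2) show "\<exists>K. compact K \<and> K \<subseteq> S \<and> (\<forall>t\<in>{0..T}. \<forall>x\<in>S - K. \<bar>u (t, x)\<bar> \<le> e * V (t, x))"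
        unfolding le_iff by (intro exI[of _ "inner_part N S r"] conjI compact_inner_part[OF N r(1)] sub)
    qed
  }
  {
    assume vanish: ?vanish
    show "Limsup at_top ?F = 0"
    proof (rule antisym)
      show "Limsup at_top ?F \<le> 0"
      proof (rule ereal_le_epsilon2)
        fix e :: real assume e: "0 < e"
        from vanish[rule_format, OF e] obtain K where K: "compact K" "K \<subseteq> S"
          "\<forall>t\<in>{0..T}. \<forall>x\<in>S - K. \<bar>u (t, x)\<bar> \<le> e * V (t, x)"
          by blast
        have "eventually (\<lambda>r. ?F r \<le> ereal e) at_top"
          using inner_part_exhausts[OF N S(1) K(1,2)]
          by eventually_elim (use K(3) in \<open>unfold le_iff, blast\<close>)
        then show "Limsup at_top ?F \<le> 0 + ereal e"
          by (simp add: Limsup_bounded)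
      qed
      have "eventually (\<lambda>r. 0 \<le> ?F r) at_top"
        using eventually_gt_at_top[of 0]
      proof eventually_elim
        case (elim r)
        obtain x where x: "x \<in> S - inner_part N S r"
          using open_Diff_compact_nonempty[OF S compact_inner_part[OF N elim] sub] by blast
        have "0 \<le> ereal (\<bar>u (0, x)\<bar> / V (0, x))"
          using V[of 0 x] x T by simp
        also have "\<dots> \<le> ?F r"
          using x T by (intro SUP_upper2[of 0] SUP_upper) auto
        finally show ?case .
      qed
      then show "0 \<le> Limsup at_top ?F"
        by (intro le_Limsup) auto
    qed
  }
qed

section \<open>Convergence in probability\<close>

text \<open>
  The truncated distances \<open>min 1 (dist (Y n) Z)\<close> are integrable and tend to \<open>0\<close> in \<open>L\<^sup>1\<close>, and
  convergence in \<open>L\<^sup>1\<close> provides an almost surely convergent subsequence.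
\<close>

lemma (in prob_space) in_probability_imp_subseq_AE:
  fixes Y :: "nat \<Rightarrow> 'a \<Rightarrow> 'b::{metric_space, second_countable_topology}"
  assumes [measurable]: "\<And>n. Y n \<in> borel_measurable M" "Z \<in> borel_measurable M"
    and lim: "\<And>e. 0 < e \<Longrightarrow> (\<lambda>n. prob {\<omega>\<in>space M. e \<le> dist (Y n \<omega>) (Z \<omega>)}) \<longlonglongrightarrow> 0"
  obtains r :: "nat \<Rightarrow> nat" where "strict_mono r" "AE \<omega> in M. (\<lambda>n. Y (r n) \<omega>) \<longlonglongrightarrow> Z \<omega>"
proof -
  define D where "D n \<omega> = min 1 (dist (Y n \<omega>) (Z \<omega>))" for n \<omega>
  have [measurable]: "D n \<in> borel_measurable M" for n
    unfolding D_def by measurable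
  have ind: "integrable M (indicat_real {\<omega>\<in>space M. e \<le> dist (Y n \<omega>) (Z \<omega>)})" for e n
    by (intro integrable_real_indicator) (auto simp: less_top[symmetric])
  have int: "integrable M (D n)" for n
    by (rule integrable_const_bound[where B=1]) (simp_all add: D_def)
  have bound: "expectation (D n) \<le> e + prob {\<omega>\<in>space M. e \<le> dist (Y n \<omega>) (Z \<omega>)}" if "0 < e" for n e
  proof -
    let ?A = "{\<omega>\<in>space M. e \<le> dist (Y n \<omega>) (Z \<omega>)}"
    have "expectation (D n) \<le> expectation (\<lambda>\<omega>. e + indicator ?A \<omega>)"
    proof (intro integral_mono int Bochner_Integration.integrable_add)
      show "D n \<omega> \<le> e + indicator ?A \<omega>" if "\<omega> \<in> space M" for \<omega>
        using that \<open>0 < e\<close> by (auto simp: D_def indicator_def)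
    qed (auto simp: ind)
    also have "\<dots> = e + prob ?A"
      by (subst Bochner_Integration.integral_add) (auto simp: prob_space ind)
    finally show ?thesis .
  qed
  have "(\<lambda>n. expectation (D n)) \<longlonglongrightarrow> 0"
  proof (rule LIMSEQ_I)
    fix e :: real assume e: "0 < e"
    have "eventually (\<lambda>n. prob {\<omega>\<in>space M. e/2 \<le> dist (Y n \<omega>) (Z \<omega>)} < e/2) sequentially"
      using e by (intro order_tendstoD[OF lim]) auto
    then have "eventually (\<lambda>n. norm (expectation (D n) - 0) < e) sequentially"
    proof eventually_elim
      case (elim n)
      have "0 \<le> expectation (D n)" by (intro integral_nonneg_AE) (auto simp: D_def)
      with bound[of "e/2" n] elim e show ?case by simp
    qed
    then show "\<exists>n0. \<forall>n\<ge>n0. norm (expectation (D n) - 0) < e"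
      by (simp add: eventually_sequentially)
  qed
  moreover have "expectation (\<lambda>\<omega>. norm (D n \<omega>)) = expectation (D n)" for n
    by (intro Bochner_Integration.integral_cong) (auto simp: D_def)
  ultimately obtain r where r: "strict_mono r" "AE \<omega> in M. (\<lambda>n. D (r n) \<omega>) \<longlonglongrightarrow> 0"
    using tendsto_L1_AE_subseq[of M D, OF int] by auto
  have "AE \<omega> in M. (\<lambda>n. Y (r n) \<omega>) \<longlonglongrightarrow> Z \<omega>"
    using r(2)
  proof eventually_elim
    case (elim \<omega>)
    have "eventually (\<lambda>n. D (r n) \<omega> < 1) sequentially"
      using elim by (rule order_tendstoD) simp
    then have "eventually (\<lambda>n. D (r n) \<omega> = dist (Y (r n) \<omega>) (Z \<omega>)) sequentially"
      by eventually_elim (auto simp: D_def min_def split: if_splits)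
    from Lim_transform_eventually[OF elim this] show ?case
      by (subst tendsto_dist_iff)
  qed
  with r(1) show thesis by (rule that)
qed

text \<open>
  If the expectations did not converge, some subsequence would stay away from the limit. Dominated
  convergence along an almost surely convergent further subsequence contradicts this. The set
  \<open>D\<close> carries all the random variables and stands for the state space, outside of which \<open>h\<close> is
  arbitrary.
\<close>

lemma (in prob_space) tendsto_expectation_in_probability:
  fixes Y :: "nat \<Rightarrow> 'a \<Rightarrow> 'b::{metric_space, second_countable_topology}" and h :: "'b \<Rightarrow> real"
  assumes Y: "\<And>n. Y n \<in> M \<rightarrow>\<^sub>M restrict_space borel D"
    and Z: "Z \<in> M \<rightarrow>\<^sub>M restrict_space borel D"
    and lim: "\<And>e. 0 < e \<Longrightarrow> (\<lambda>n. prob {\<omega>\<in>space M. e \<le> dist (Y n \<omega>) (Z \<omega>)}) \<longlonglongrightarrow> 0"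
    and h: "continuous_on D h" and B: "\<And>y. y \<in> D \<Longrightarrow> \<bar>h y\<bar> \<le> B"
  shows "(\<lambda>n. expectation (\<lambda>\<omega>. h (Y n \<omega>))) \<longlonglongrightarrow> expectation (\<lambda>\<omega>. h (Z \<omega>))"
proof (rule ccontr)
  let ?E = "\<lambda>n. expectation (\<lambda>\<omega>. h (Y n \<omega>))" and ?L = "expectation (\<lambda>\<omega>. h (Z \<omega>))"
  assume "\<not> ?E \<longlonglongrightarrow> ?L"
  then obtain e where e: "0 < e" and "\<not> eventually (\<lambda>n. dist (?E n) ?L < e) sequentially"
    unfolding tendsto_iff by blast
  then have "\<forall>N. \<exists>n>N. e \<le> dist (?E n) ?L"
    unfolding eventually_sequentially by (meson less_imp_le_nat not_less Suc_le_eq)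
  then have "infinite {n. e \<le> dist (?E n) ?L}"
    unfolding infinite_nat_iff_unbounded by blast
  then obtain q :: "nat \<Rightarrow> nat" where q: "strict_mono q" "\<And>n. e \<le> dist (?E (q n)) ?L"
    by (auto dest!: infinite_enumerate)
  have mem: "Y n \<omega> \<in> D" "Z \<omega> \<in> D" if "\<omega> \<in> space M" for n \<omega>
    using measurable_space[OF Y that, of n] measurable_space[OF Z that] by (auto simp: space_restrict_space)
  have [measurable]: "Y n \<in> borel_measurable M" "Z \<in> borel_measurable M" for n
    using Y Z by (auto simp: measurable_restrict_space2_iff)
  have hm: "(\<lambda>\<omega>. h (Y n \<omega>)) \<in> borel_measurable M" "(\<lambda>\<omega>. h (Z \<omega>)) \<in> borel_measurable M" for n
    using measurable_compose[OF Y borel_measurable_continuous_on_restrict[OF h]]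
      measurable_compose[OF Z borel_measurable_continuous_on_restrict[OF h]] by auto
  obtain r where r: "strict_mono r" "AE \<omega> in M. (\<lambda>n. Y (q (r n)) \<omega>) \<longlonglongrightarrow> Z \<omega>"
  proof (rule in_probability_imp_subseq_AE[of "\<lambda>n. Y (q n)" Z])
    show "(\<lambda>n. prob {\<omega>\<in>space M. e \<le> dist (Y (q n) \<omega>) (Z \<omega>)}) \<longlonglongrightarrow> 0" if "0 < e" for e
      using LIMSEQ_subseq_LIMSEQ[OF lim[OF that] q(1)] by (simp add: o_def)
  qed auto
  have "(\<lambda>n. ?E (q (r n))) \<longlonglongrightarrow> ?L"
  proof (rule integral_dominated_convergence[where w="\<lambda>_. B"])
    show "AE \<omega> in M. (\<lambda>n. h (Y (q (r n)) \<omega>)) \<longlonglongrightarrow> h (Z \<omega>)"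
      using r(2) AE_space
    proof eventually_elim
      case (elim \<omega>)
      then show ?case
        by (intro continuous_on_tendsto_compose[OF h]) (auto simp: mem)
    qed
    show "AE \<omega> in M. norm (h (Y (q (r n)) \<omega>)) \<le> B" for n
      by (rule AE_I2) (auto intro: B mem)
  qed (auto intro: hm)
  then have "eventually (\<lambda>n. dist (?E (q (r n))) ?L < e) sequentially"
    using e by (simp add: tendsto_iff)
  then show False
    using q(2) by (auto simp: eventually_sequentially not_less[symmetric])
qed

text \<open>
  With \<open>c * norm x \<le> N x\<close>, the event that \<open>Y n\<close> and \<open>Z\<close> have distance at least \<open>e\<close> is contained in
  the event \<open>c * e \<le> N (Y n - Z)\<close>.
\<close>

lemma in_probability_norm_imp_dist:
  fixes N :: "'a::euclidean_space \<Rightarrow> real"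
  assumes "prob_space M" and N: "is_norm N"
    and meas: "\<And>n. Y n \<in> borel_measurable M" "Z \<in> borel_measurable M"
    and lim: "\<And>e. 0 < e \<Longrightarrow>
      limsup (\<lambda>n. ereal (measure M {\<omega>\<in>space M. e \<le> N (Y n \<omega> - Z \<omega>)})) = 0"
    and e: "0 < e"
  shows "(\<lambda>n. measure M {\<omega>\<in>space M. e \<le> dist (Y n \<omega>) (Z \<omega>)}) \<longlonglongrightarrow> 0"
proof (rule tendstoI)
  interpret prob_space M by fact
  note [measurable] = meas borel_measurable_continuous_onI[OF is_norm_continuous_on[OF N]]
  obtain c where c: "0 < c" "\<And>x. c * norm x \<le> N x"
    using is_norm_lower_bound[OF N] by metis
  fix \<eta> :: real assume \<eta>: "0 < \<eta>"
  have "eventually (\<lambda>n. ereal (prob {\<omega>\<in>space M. c * e \<le> N (Y n \<omega> - Z \<omega>)}) < ereal \<eta>) sequentially"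
    using lim[of "c * e"] c(1) e \<eta> by (intro Limsup_lessD) simp
  then show "eventually (\<lambda>n. dist (prob {\<omega>\<in>space M. e \<le> dist (Y n \<omega>) (Z \<omega>)}) 0 < \<eta>) sequentially"
  proof eventually_elim
    case (elim n)
    have "prob {\<omega>\<in>space M. e \<le> dist (Y n \<omega>) (Z \<omega>)} \<le> prob {\<omega>\<in>space M. c * e \<le> N (Y n \<omega> - Z \<omega>)}"
    proof (rule finite_measure_mono)
      show "{\<omega>\<in>space M. e \<le> dist (Y n \<omega>) (Z \<omega>)} \<subseteq> {\<omega>\<in>space M. c * e \<le> N (Y n \<omega> - Z \<omega>)}"
      proof clarsimp
        fix \<omega> assume "e \<le> dist (Y n \<omega>) (Z \<omega>)"
        then have "c * e \<le> c * norm (Y n \<omega> - Z \<omega>)"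
          using c(1) by (simp add: dist_norm)
        then show "c * e \<le> N (Y n \<omega> - Z \<omega>)"
          using c(2) order_trans by blast
      qed
    qed measurable
    with elim show ?case by simp
  qed
qed

section \<open>Expectations along a process with a Lyapunov function\<close>

lemma measurable_joint_section:
  assumes "(\<lambda>(s, \<omega>). Y s \<omega>) \<in> restrict_space borel A \<Otimes>\<^sub>M M \<rightarrow>\<^sub>M N" "s \<in> A"
  shows "Y s \<in> M \<rightarrow>\<^sub>M N"
proof -
  have "(\<lambda>\<omega>. (s, \<omega>)) \<in> M \<rightarrow>\<^sub>M restrict_space borel A \<Otimes>\<^sub>M M"
    using assms(2) by (intro measurable_Pair) (auto simp: space_restrict_space)
  from measurable_compose[OF this assms(1)] show ?thesis
    by simp
qed

lemma time_integral_bound: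
  fixes t T B :: real
  assumes "t \<in> {0..T}" "set_integrable lborel {t..T} k" "0 \<le> B" "\<And>s. s \<in> {t..T} \<Longrightarrow> \<bar>k s\<bar> \<le> B"
  shows "\<bar>LBINT s:{t..T}. k s\<bar> \<le> T * B"
proof -
  have "integrable lborel (\<lambda>s. indicat_real {t..T} s *\<^sub>R B)"
    by (intro integrable_scaleR_left integrable_real_indicator) (auto simp: emeasure_lborel_Icc_eq)
  then have "\<bar>LBINT s:{t..T}. k s\<bar> \<le> (LBINT s:{t..T}. B)"
    unfolding set_lebesgue_integral_def using assms(2,4)
    by (intro Bochner_Integration.integral_abs_bound_integral)
      (auto simp: set_integrable_def indicator_def abs_mult)
  also have "\<dots> = (T - t) * B"
    using assms(1) by (simp add: set_lebesgue_integral_def)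
  also have "\<dots> \<le> T * B"
    using assms(1,3) by (intro mult_right_mono) auto
  finally show ?thesis .
qed

text \<open>
  The assumptions on the processes \<open>X t x\<close> and the Lyapunov function \<open>V\<close> in the form in which the
  analysis uses them. Growth bounds relative to \<open>V\<close> take the place of boundary behaviour, so that
  coercivity of \<open>V\<close> is reduced to the lower bound \<open>\<delta>\<close> and \<open>S\<close> can be any set.
\<close>

locale controlled_process = prob_space M for M :: "'w measure" +
  fixes T \<delta> :: real
    and S :: "'a::{metric_space, second_countable_topology} set"
    and X :: "real \<Rightarrow> 'a \<Rightarrow> real \<Rightarrow> 'w \<Rightarrow> 'a"
    and V :: "real \<times> 'a \<Rightarrow> real"
  assumes X_measurable: "\<And>t x. t \<in> {0..T} \<Longrightarrow> x \<in> S \<Longrightarrow>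
      (\<lambda>(s, \<omega>). X t x s \<omega>) \<in> restrict_space borel {t..T} \<Otimes>\<^sub>M M \<rightarrow>\<^sub>M restrict_space borel S"
    and X_continuous: "\<And>e s t x \<tau> \<xi>. 0 < e \<Longrightarrow> s \<in> {0..T} \<Longrightarrow> t \<in> {0..T} \<Longrightarrow> x \<in> S \<Longrightarrow>
      (\<And>n::nat. \<tau> n \<in> {0..T}) \<Longrightarrow> (\<And>n. \<xi> n \<in> S) \<Longrightarrow> \<tau> \<longlonglongrightarrow> t \<Longrightarrow> \<xi> \<longlonglongrightarrow> x \<Longrightarrow>
      (\<lambda>n. prob {\<omega>\<in>space M.
        e \<le> dist (X (\<tau> n) (\<xi> n) (max s (\<tau> n)) \<omega>) (X t x (max s t) \<omega>)}) \<longlonglongrightarrow> 0"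
    and V_continuous: "continuous_on ({0..T} \<times> S) V"
    and \<delta>_pos: "0 < \<delta>"
    and V_ge: "\<And>t x. t \<in> {0..T} \<Longrightarrow> x \<in> S \<Longrightarrow> \<delta> \<le> V (t, x)"
    and V_supermartingale: "\<And>t s x. t \<in> {0..T} \<Longrightarrow> s \<in> {t..T} \<Longrightarrow> x \<in> S \<Longrightarrow>
      (\<integral>\<^sup>+ \<omega>. ennreal (V (s, X t x s \<omega>)) \<partial>M) \<le> ennreal (V (t, x))"
begin

text \<open>
  The growth condition \<open>h = o(V)\<close> in the regime where \<open>V\<close> is large. Unlike decay of \<open>h / V\<close> at the
  boundary, a bound \<open>C + e * V\<close> holds at every point and can therefore be integrated along the
  process.
\<close>

definition sublinear :: "(real \<times> 'a \<Rightarrow> real) \<Rightarrow> bool" where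
  "sublinear h \<longleftrightarrow> (\<forall>e>0. \<exists>C\<ge>0. \<forall>t\<in>{0..T}. \<forall>x\<in>S. \<bar>h (t, x)\<bar> \<le> C + e * V (t, x))"

definition admissible :: "(real \<times> 'a \<Rightarrow> real) \<Rightarrow> bool" where
  "admissible h \<longleftrightarrow> continuous_on ({0..T} \<times> S) h \<and> sublinear h"

lemma V_pos: "t \<in> {0..T} \<Longrightarrow> x \<in> S \<Longrightarrow> 0 < V (t, x)"
  using V_ge[of t x] \<delta>_pos by linarith

lemma sublinearE:
  assumes "sublinear h" "0 < e"
  obtains C where "0 \<le> C" "\<And>t x. t \<in> {0..T} \<Longrightarrow> x \<in> S \<Longrightarrow> \<bar>h (t, x)\<bar> \<le> C + e * V (t, x)"
proof -
  have "\<exists>C\<ge>0. \<forall>t\<in>{0..T}. \<forall>x\<in>S. \<bar>h (t, x)\<bar> \<le> C + e * V (t, x)"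
    using assms by (simp add: sublinear_def)
  with that show thesis by meson
qed

lemma sublinear_imp_bounded:
  assumes "sublinear h"
  obtains a where "0 \<le> a" "\<And>t x. t \<in> {0..T} \<Longrightarrow> x \<in> S \<Longrightarrow> \<bar>h (t, x)\<bar> \<le> a * V (t, x)"
proof -
  obtain C where C: "0 \<le> C" "\<And>t x. t \<in> {0..T} \<Longrightarrow> x \<in> S \<Longrightarrow> \<bar>h (t, x)\<bar> \<le> C + 1 * V (t, x)"
    using sublinearE[OF assms zero_less_one] by metis
  show thesis
  proof (rule that[of "C / \<delta> + 1"])
    fix t x assume tx: "t \<in> {0..T}" "x \<in> S"
    have "C = C / \<delta> * \<delta>" using \<delta>_pos by simp
    also have "\<dots> \<le> C / \<delta> * V (t, x)"
      using C(1) \<delta>_pos V_ge[OF tx] by (intro mult_left_mono) auto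
    finally show "\<bar>h (t, x)\<bar> \<le> (C / \<delta> + 1) * V (t, x)"
      using C(2)[OF tx] by (simp add: algebra_simps)
  qed (use C(1) \<delta>_pos in simp)
qed

lemma X_in: "t \<in> {0..T} \<Longrightarrow> x \<in> S \<Longrightarrow> s \<in> {t..T} \<Longrightarrow> \<omega> \<in> space M \<Longrightarrow> X t x s \<omega> \<in> S"
  using measurable_space[OF X_measurable, of t x "(s, \<omega>)"]
  by (simp add: space_pair_measure space_restrict_space)

lemma X_section:
  assumes "t \<in> {0..T}" "x \<in> S" "s \<in> {t..T}"
  shows "X t x s \<in> M \<rightarrow>\<^sub>M restrict_space borel S"
  by (rule measurable_joint_section[OF X_measurable[OF assms(1,2)] assms(3)])

lemma measurable_section:
  assumes "t \<in> {0..T}" "x \<in> S" "s \<in> {t..T}" "continuous_on S \<phi>"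
  shows "(\<lambda>\<omega>. \<phi> (X t x s \<omega>) :: real) \<in> borel_measurable M"
  using measurable_compose[OF X_section[OF assms(1-3)] borel_measurable_continuous_on_restrict[OF assms(4)]] .

lemma continuous_on_slice:
  fixes h :: "real \<times> 'a \<Rightarrow> real"
  assumes "continuous_on ({0..T} \<times> S) h" "s \<in> {0..T}"
  shows "continuous_on S (\<lambda>y. h (s, y))"
  by (rule continuous_on_compose2[OF assms(1)]) (use assms(2) in \<open>auto intro!: continuous_intros\<close>)

text \<open>
  The only place where the supermartingale inequality enters: bounds of the form \<open>C + a * V\<close> pass to
  expectations with unchanged constants. The case \<open>C = 0\<close> serves for the contraction, the case of
  small \<open>a\<close> for growth and continuity.
\<close>

lemma expectation_bound:
  assumes t: "t \<in> {0..T}" and x: "x \<in> S" and s: "s \<in> {t..T}" and \<phi>: "continuous_on S \<phi>"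
    and C: "0 \<le> C" and a: "0 \<le> a" and bound: "\<And>y. y \<in> S \<Longrightarrow> \<bar>\<phi> y\<bar> \<le> C + a * V (s, y)"
  shows "integrable M (\<lambda>\<omega>. \<phi> (X t x s \<omega>))"
    and "\<bar>expectation (\<lambda>\<omega>. \<phi> (X t x s \<omega>))\<bar> \<le> C + a * V (t, x)"
proof -
  have s': "s \<in> {0..T}" using s t by auto
  have V_meas: "(\<lambda>\<omega>. V (s, X t x s \<omega>)) \<in> borel_measurable M"
    by (rule measurable_section[OF t x s continuous_on_slice[OF V_continuous s']])
  note [measurable] = V_meas measurable_section[OF t x s \<phi>]
  have "(\<integral>\<^sup>+ \<omega>. ennreal \<bar>\<phi> (X t x s \<omega>)\<bar> \<partial>M) \<le> (\<integral>\<^sup>+ \<omega>. ennreal C + ennreal a * ennreal (V (s, X t x s \<omega>)) \<partial>M)"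
  proof (rule nn_integral_mono)
    fix \<omega> assume "\<omega> \<in> space M"
    then have in_S: "X t x s \<omega> \<in> S" by (rule X_in[OF t x s])
    then have "ennreal \<bar>\<phi> (X t x s \<omega>)\<bar> \<le> ennreal (C + a * V (s, X t x s \<omega>))"
      by (intro ennreal_leI bound)
    also have "\<dots> = ennreal C + ennreal a * ennreal (V (s, X t x s \<omega>))"
      using C a V_pos[OF s' in_S] by (simp add: ennreal_plus ennreal_mult)
    finally show "ennreal \<bar>\<phi> (X t x s \<omega>)\<bar> \<le> ennreal C + ennreal a * ennreal (V (s, X t x s \<omega>))" .
  qed
  also have "\<dots> = ennreal C + ennreal a * (\<integral>\<^sup>+ \<omega>. ennreal (V (s, X t x s \<omega>)) \<partial>M)"
    by (simp add: nn_integral_add nn_integral_cmult emeasure_space_1)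
  also have "\<dots> \<le> ennreal C + ennreal a * ennreal (V (t, x))"
    by (intro add_left_mono mult_left_mono V_supermartingale t x s) auto
  also have "\<dots> = ennreal (C + a * V (t, x))"
    using C a V_pos[OF t x] by (simp add: ennreal_plus ennreal_mult)
  finally have le: "(\<integral>\<^sup>+ \<omega>. ennreal \<bar>\<phi> (X t x s \<omega>)\<bar> \<partial>M) \<le> ennreal (C + a * V (t, x))" .
  show int: "integrable M (\<lambda>\<omega>. \<phi> (X t x s \<omega>))"
    by (rule integrableI_bounded) (use le in \<open>auto simp: le_less_trans[OF le]\<close>)
  have "\<bar>expectation (\<lambda>\<omega>. \<phi> (X t x s \<omega>))\<bar> \<le> expectation (\<lambda>\<omega>. \<bar>\<phi> (X t x s \<omega>)\<bar>)"
    using integral_norm_bound[of M "\<lambda>\<omega>. \<phi> (X t x s \<omega>)"] by simp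
  also have "ennreal \<dots> \<le> ennreal (C + a * V (t, x))"
    using le by (subst nn_integral_eq_integral[symmetric]) (auto intro: int)
  then have "expectation (\<lambda>\<omega>. \<bar>\<phi> (X t x s \<omega>)\<bar>) \<le> C + a * V (t, x)"
    using C a V_pos[OF t x] by (subst (asm) ennreal_le_iff) auto
  finally show "\<bar>expectation (\<lambda>\<omega>. \<phi> (X t x s \<omega>))\<bar> \<le> C + a * V (t, x)" .
qed

text \<open>
  The starting times \<open>\<tau> n\<close> may exceed \<open>s\<close>, so the processes are evaluated at \<open>max s (\<tau> n)\<close>. Pairing
  this time with the state reduces the claim to convergence in probability in \<open>{0..T} \<times> S\<close>.
\<close>

lemma tendsto_expectation_bounded:
  fixes k :: "real \<times> 'a \<Rightarrow> real"
  assumes k: "continuous_on ({0..T} \<times> S) k" and C: "\<And>p. \<bar>k p\<bar> \<le> C"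
    and s: "s \<in> {0..T}" and t: "t \<in> {0..T}" and x: "x \<in> S"
    and \<tau>: "\<And>n. \<tau> n \<in> {0..T}" and \<xi>: "\<And>n. \<xi> n \<in> S" and lim: "\<tau> \<longlonglongrightarrow> t" "\<xi> \<longlonglongrightarrow> x"
  shows "(\<lambda>n. expectation (\<lambda>\<omega>. k (max s (\<tau> n), X (\<tau> n) (\<xi> n) (max s (\<tau> n)) \<omega>)))
    \<longlonglongrightarrow> expectation (\<lambda>\<omega>. k (max s t, X t x (max s t) \<omega>))"
proof (rule tendsto_expectation_in_probability[OF _ _ _ k C])
  have meas: "(\<lambda>\<omega>. (max s t, X t x (max s t) \<omega>)) \<in> M \<rightarrow>\<^sub>M restrict_space borel ({0..T} \<times> S)"
    if t: "t \<in> {0..T}" and x: "x \<in> S" for t x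
  proof -
    have m: "max s t \<in> {t..T}" using s t by auto
    have [measurable]: "X t x (max s t) \<in> borel_measurable M"
      using X_section[OF t x m] by (simp add: measurable_restrict_space2_iff)
    show ?thesis
      using s t X_in[OF t x m] by (intro measurable_restrict_space2) auto
  qed
  show "(\<lambda>\<omega>. (max s t, X t x (max s t) \<omega>)) \<in> M \<rightarrow>\<^sub>M restrict_space borel ({0..T} \<times> S)"
    by (rule meas[OF t x])
  show "(\<lambda>\<omega>. (max s (\<tau> n), X (\<tau> n) (\<xi> n) (max s (\<tau> n)) \<omega>)) \<in> M \<rightarrow>\<^sub>M restrict_space borel ({0..T} \<times> S)" for n
    by (rule meas[OF \<tau> \<xi>])
  fix e :: real assume e: "0 < e"
  let ?Y = "\<lambda>n. X (\<tau> n) (\<xi> n) (max s (\<tau> n))" and ?Z = "X t x (max s t)"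
  let ?P = "\<lambda>n. {\<omega>\<in>space M. e \<le> dist (max s (\<tau> n), ?Y n \<omega>) (max s t, ?Z \<omega>)}"
  let ?Q = "\<lambda>n. {\<omega>\<in>space M. e/2 \<le> dist (?Y n \<omega>) (?Z \<omega>)}"
  have "(\<lambda>n. max s (\<tau> n)) \<longlonglongrightarrow> max s t"
    by (intro tendsto_intros lim)
  then have "eventually (\<lambda>n. dist (max s (\<tau> n)) (max s t) < e/2) sequentially"
    using e by (intro tendstoD) auto
  then have le: "eventually (\<lambda>n. prob (?P n) \<le> prob (?Q n)) sequentially"
  proof eventually_elim
    case (elim n)
    have "max s t \<in> {t..T}" "max s (\<tau> n) \<in> {\<tau> n..T}" using s t \<tau>[of n] by auto
    then have [measurable]: "?Z \<in> borel_measurable M" "?Y n \<in> borel_measurable M"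
      using X_section[OF t x, of "max s t"] X_section[OF \<tau> \<xi>, of "max s (\<tau> n)" n n]
      by (simp_all add: measurable_restrict_space2_iff)
    show ?case
    proof (rule finite_measure_mono)
      show "?P n \<subseteq> ?Q n"
      proof (clarsimp)
        fix \<omega> assume "e \<le> dist (max s (\<tau> n), ?Y n \<omega>) (max s t, ?Z \<omega>)"
        also have "\<dots> \<le> dist (max s (\<tau> n)) (max s t) + dist (?Y n \<omega>) (?Z \<omega>)"
          unfolding dist_Pair_Pair by (rule sqrt_sum_squares_le_sum) auto
        finally show "e \<le> dist (?Y n \<omega>) (?Z \<omega>) * 2"
          using elim by simp
      qed
    qed measurable
  qed
  show "(\<lambda>n. prob (?P n)) \<longlonglongrightarrow> 0"
    by (rule tendsto_sandwich[OF _ le tendsto_const X_continuous[OF _ s t x \<tau> \<xi> lim]])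
      (use e in auto)
qed

text \<open>
  Clipping \<open>h\<close> to \<open>[-C, C]\<close> costs at most \<open>\<eta> * V\<close> wherever \<open>\<bar>h\<bar> \<le> C + \<eta> * V\<close>. The expected error is
  thus at most \<open>\<eta> * V\<close> at the starting point, which is small uniformly along a convergent sequence of
  starting points. The growth bound is demanded from time \<open>s\<close> on only: for \<open>s = T\<close> this covers the
  terminal condition, which is controlled by \<open>V\<close> at the final time.
\<close>

lemma tendsto_expectation:
  fixes h :: "real \<times> 'a \<Rightarrow> real"
  assumes h: "continuous_on ({0..T} \<times> S) h"
    and growth: "\<And>e. 0 < e \<Longrightarrow> \<exists>C\<ge>0. \<forall>r\<in>{s..T}. \<forall>y\<in>S. \<bar>h (r, y)\<bar> \<le> C + e * V (r, y)"
    and s: "s \<in> {0..T}" and t: "t \<in> {0..T}" and x: "x \<in> S"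
    and \<tau>: "\<And>n. \<tau> n \<in> {0..T}" and \<xi>: "\<And>n. \<xi> n \<in> S" and lim: "\<tau> \<longlonglongrightarrow> t" "\<xi> \<longlonglongrightarrow> x"
  shows "(\<lambda>n. expectation (\<lambda>\<omega>. h (max s (\<tau> n), X (\<tau> n) (\<xi> n) (max s (\<tau> n)) \<omega>)))
    \<longlonglongrightarrow> expectation (\<lambda>\<omega>. h (max s t, X t x (max s t) \<omega>))"
  unfolding tendsto_iff
proof (intro allI impI)
  fix e :: real assume e: "0 < e"
  define W where "W = V (t, x) + 1"
  have W: "0 < W" "V (t, x) < W" using V_pos[OF t x] by (auto simp: W_def)
  (* Eventually V (\<tau> n, \<xi> n) < W, so each of the two truncation errors is at most \<eta> * W = e / 3. *)
  define \<eta> where "\<eta> = e / (3 * W)"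
  have \<eta>: "0 < \<eta>" "\<eta> * W = e / 3" using e W by (auto simp: \<eta>_def)
  obtain C where C: "0 \<le> C" "\<And>r y. r \<in> {s..T} \<Longrightarrow> y \<in> S \<Longrightarrow> \<bar>h (r, y)\<bar> \<le> C + \<eta> * V (r, y)"
    using growth[OF \<eta>(1)] by blast
  (* Truncation at the level C, the constant belonging to the slope \<eta>. *)
  define k where "k p = max (- C) (min C (h p))" for p
  have k: "continuous_on ({0..T} \<times> S) k"
    unfolding k_def by (intro continuous_intros h)
  have k_le: "\<bar>k p\<bar> \<le> C" for p
    using C(1) by (auto simp: k_def)
  have close: "\<bar>expectation (\<lambda>\<omega>. h (r, X t' x' r \<omega>)) - expectation (\<lambda>\<omega>. k (r, X t' x' r \<omega>))\<bar> \<le> \<eta> * V (t', x')"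
    if t': "t' \<in> {0..T}" and x': "x' \<in> S" and r: "r \<in> {s..T}" "r \<in> {t'..T}" for r t' x'
  proof -
    have r': "r \<in> {0..T}" using r(2) t' by auto
    have diff: "\<bar>h (r, y) - k (r, y)\<bar> \<le> 0 + \<eta> * V (r, y)" if "y \<in> S" for y
      using C(2)[OF r(1) that] \<eta>(1) V_pos[OF r' that] by (auto simp: k_def max_def min_def abs_if split: if_splits)
    note hc = continuous_on_slice[OF h r'] and kc = continuous_on_slice[OF k r']
    have "integrable M (\<lambda>\<omega>. h (r, X t' x' r \<omega>))"
      by (rule expectation_bound[OF t' x' r(2) hc C(1), of \<eta>]) (use C(2)[OF r(1)] \<eta>(1) in auto)
    moreover have "integrable M (\<lambda>\<omega>. k (r, X t' x' r \<omega>))"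
      by (rule expectation_bound[OF t' x' r(2) kc C(1), of 0]) (use k_le in auto)
    moreover have "\<bar>expectation (\<lambda>\<omega>. h (r, X t' x' r \<omega>) - k (r, X t' x' r \<omega>))\<bar> \<le> 0 + \<eta> * V (t', x')"
      using diff \<eta>(1) by (intro expectation_bound[OF t' x' r(2) continuous_on_diff[OF hc kc]]) auto
    ultimately show ?thesis by simp
  qed
  let ?h = "\<lambda>n. expectation (\<lambda>\<omega>. h (max s (\<tau> n), X (\<tau> n) (\<xi> n) (max s (\<tau> n)) \<omega>))"
  let ?k = "\<lambda>n. expectation (\<lambda>\<omega>. k (max s (\<tau> n), X (\<tau> n) (\<xi> n) (max s (\<tau> n)) \<omega>))"
  let ?h_lim = "expectation (\<lambda>\<omega>. h (max s t, X t x (max s t) \<omega>))"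
  let ?k_lim = "expectation (\<lambda>\<omega>. k (max s t, X t x (max s t) \<omega>))"
  have "(\<lambda>n. V (\<tau> n, \<xi> n)) \<longlonglongrightarrow> V (t, x)"
    using t x \<tau> \<xi> by (intro continuous_on_tendsto_compose[OF V_continuous] tendsto_Pair lim) auto
  then have "eventually (\<lambda>n. V (\<tau> n, \<xi> n) < W) sequentially"
    using W(2) by (rule order_tendstoD)
  moreover have "eventually (\<lambda>n. dist (?k n) ?k_lim < e/3) sequentially"
    using e by (intro tendstoD tendsto_expectation_bounded[OF k k_le s t x \<tau> \<xi> lim]) auto
  ultimately show "eventually (\<lambda>n. dist (?h n) ?h_lim < e) sequentially"
  proof eventually_elim
    case (elim n)
    have "\<bar>?h n - ?k n\<bar> \<le> \<eta> * V (\<tau> n, \<xi> n)"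
      using s \<tau>[of n] by (intro close \<tau> \<xi>) auto
    also have "\<dots> \<le> e/3" using elim mult_left_mono[of "V (\<tau> n, \<xi> n)" W \<eta>] \<eta> by linarith
    finally have 1: "\<bar>?h n - ?k n\<bar> \<le> e/3" .
    have "\<bar>?h_lim - ?k_lim\<bar> \<le> \<eta> * V (t, x)"
      using s t by (intro close t x) auto
    also have "\<dots> \<le> e/3" using W mult_left_mono[of "V (t, x)" W \<eta>] \<eta> by linarith
    finally have 2: "\<bar>?h_lim - ?k_lim\<bar> \<le> e/3" .
    show ?case using 1 2 elim(2) unfolding dist_real_def by linarith
  qed
qed

text \<open>
  The process is only given for times in \<open>{t..T}\<close>. Precomposing with the projection \<open>c\<close> of the line
  onto this interval extends it measurably to all times, so that Fubini's theorem for \<open>lborel\<close> and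
  \<open>M\<close> applies. Integrability on the product follows from \<open>E \<bar>h\<bar> \<le> a * V (t, x)\<close> at each time.
\<close>

lemma path_integral_Fubini:
  fixes h :: "real \<times> 'a \<Rightarrow> real"
  assumes "admissible h" and t: "t \<in> {0..T}" and x: "x \<in> S"
  shows "AE \<omega> in M. set_integrable lborel {t..T} (\<lambda>s. h (s, X t x s \<omega>))"
    and "integrable M (\<lambda>\<omega>. LBINT s:{t..T}. h (s, X t x s \<omega>))"
    and "set_integrable lborel {t..T} (\<lambda>s. expectation (\<lambda>\<omega>. h (s, X t x s \<omega>)))"
    and "expectation (\<lambda>\<omega>. LBINT s:{t..T}. h (s, X t x s \<omega>))
      = (LBINT s:{t..T}. expectation (\<lambda>\<omega>. h (s, X t x s \<omega>)))"
proof -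
  have h: "continuous_on ({0..T} \<times> S) h" and "sublinear h"
    using assms(1) by (auto simp: admissible_def)
  from sublinear_imp_bounded[OF this(2)]
  obtain a where a: "0 \<le> a" "\<And>t x. t \<in> {0..T} \<Longrightarrow> x \<in> S \<Longrightarrow> \<bar>h (t, x)\<bar> \<le> a * V (t, x)"
    by blast
  interpret P: pair_sigma_finite lborel M
    by (rule pair_sigma_finite.intro) unfold_locales
  define c where "c s = max t (min T s)" for s
  have c_in: "c s \<in> {t..T}" for s using t by (auto simp: c_def)
  have c_id: "s \<in> {t..T} \<Longrightarrow> c s = s" for s by (auto simp: c_def)
  have [measurable]: "c \<in> borel_measurable borel" unfolding c_def by measurable
  have "(\<lambda>(s, \<omega>). (c s, \<omega>)) \<in> lborel \<Otimes>\<^sub>M M \<rightarrow>\<^sub>M restrict_space borel {t..T} \<Otimes>\<^sub>M M"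
    unfolding split_beta using c_in
    by (intro measurable_Pair measurable_restrict_space2) (auto intro!: measurable_compose[OF measurable_fst])
  from measurable_compose[OF this X_measurable[OF t x]]
  have "(\<lambda>(s, \<omega>). X t x (c s) \<omega>) \<in> lborel \<Otimes>\<^sub>M M \<rightarrow>\<^sub>M restrict_space borel S"
    by (simp add: split_beta)
  then have [measurable]: "(\<lambda>(s, \<omega>). X t x (c s) \<omega>) \<in> lborel \<Otimes>\<^sub>M M \<rightarrow>\<^sub>M borel"
    by (simp add: measurable_restrict_space2_iff)
  have "(\<lambda>(s, \<omega>). (c s, X t x (c s) \<omega>)) \<in> lborel \<Otimes>\<^sub>M M \<rightarrow>\<^sub>M restrict_space borel ({0..T} \<times> S)"
  proof (rule measurable_restrict_space2)
    show "(\<lambda>(s, \<omega>). (c s, X t x (c s) \<omega>)) \<in> space (lborel \<Otimes>\<^sub>M M) \<rightarrow> {0..T} \<times> S"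
      using X_in[OF t x c_in] order_trans[OF _ c_in[THEN atLeastAtMost_iff[THEN iffD1], THEN conjunct1]] c_in t
      by (auto simp: space_pair_measure)
  qed measurable
  from measurable_compose[OF this borel_measurable_continuous_on_restrict[OF h]]
  have [measurable]: "(\<lambda>(s, \<omega>). h (c s, X t x (c s) \<omega>)) \<in> borel_measurable (lborel \<Otimes>\<^sub>M M)"
    by (simp add: split_beta)
  define F where "F s \<omega> = indicator {t..T} s * h (c s, X t x (c s) \<omega>)" for s \<omega>
  have F_eq: "F s \<omega> = indicator {t..T} s *\<^sub>R h (s, X t x s \<omega>)" for s \<omega>
    by (simp add: F_def c_id indicator_def)
  have F_meas [measurable]: "case_prod F \<in> borel_measurable (lborel \<Otimes>\<^sub>M M)"
    unfolding F_def by measurable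
  have slice: "integrable M (\<lambda>\<omega>. h (s, X t x s \<omega>))"
      "\<bar>expectation (\<lambda>\<omega>. \<bar>h (s, X t x s \<omega>)\<bar>)\<bar> \<le> a * V (t, x)" if s: "s \<in> {t..T}" for s
  proof -
    have s': "s \<in> {0..T}" using s t by auto
    note hc = continuous_on_slice[OF h s']
    show "integrable M (\<lambda>\<omega>. h (s, X t x s \<omega>))"
      by (rule expectation_bound[OF t x s hc order_refl a(1)]) (use a(2)[OF s'] in simp)
    have "\<bar>expectation (\<lambda>\<omega>. \<bar>h (s, X t x s \<omega>)\<bar>)\<bar> \<le> 0 + a * V (t, x)"
      by (rule expectation_bound[OF t x s continuous_on_rabs[OF hc] order_refl a(1)]) (use a(2)[OF s'] in simp)
    then show "\<bar>expectation (\<lambda>\<omega>. \<bar>h (s, X t x s \<omega>)\<bar>)\<bar> \<le> a * V (t, x)" by simp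
  qed
  have int: "integrable (lborel \<Otimes>\<^sub>M M) (case_prod F)"
  proof (rule P.Fubini_integrable)
    have "integrable lborel (\<lambda>s. expectation (\<lambda>\<omega>. norm (F s \<omega>)))"
    proof (rule Bochner_Integration.integrable_bound)
      show "integrable lborel (\<lambda>s. indicator {t..T} s * (a * V (t, x)))"
        by (intro integrable_mult_left integrable_real_indicator) (auto simp: emeasure_lborel_Icc_eq)
      show "AE s in lborel. norm (expectation (\<lambda>\<omega>. norm (F s \<omega>))) \<le> norm (indicator {t..T} s * (a * V (t, x)))"
        using slice(2) a(1) V_pos[OF t x] by (intro AE_I2) (auto simp: F_eq indicator_def)
    qed measurable
    then show "integrable lborel (\<lambda>s. \<integral>\<omega>. norm (case_prod F (s, \<omega>)) \<partial>M)" by simp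
    show "AE s in lborel. integrable M (\<lambda>\<omega>. case_prod F (s, \<omega>))"
      using slice(1) by (intro AE_I2) (auto simp: F_eq indicator_def)
  qed measurable
  show "AE \<omega> in M. set_integrable lborel {t..T} (\<lambda>s. h (s, X t x s \<omega>))"
    using P.AE_integrable_snd[OF int] by (simp add: F_eq set_integrable_def)
  show "integrable M (\<lambda>\<omega>. LBINT s:{t..T}. h (s, X t x s \<omega>))"
    using P.integrable_snd[OF int] by (simp add: F_eq set_lebesgue_integral_def)
  show "set_integrable lborel {t..T} (\<lambda>s. expectation (\<lambda>\<omega>. h (s, X t x s \<omega>)))"
    using P.integrable_fst[OF int] by (simp add: F_eq set_integrable_def)
  show "expectation (\<lambda>\<omega>. LBINT s:{t..T}. h (s, X t x s \<omega>))
      = (LBINT s:{t..T}. expectation (\<lambda>\<omega>. h (s, X t x s \<omega>)))"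
    using P.Fubini_integral[OF int] by (simp add: F_eq set_lebesgue_integral_def)
qed

text \<open>
  For \<open>s \<noteq> t\<close> the integrands, extended by \<open>0\<close> to the left of the starting time, converge:
  to the left of \<open>t\<close> they eventually vanish, and to the right of \<open>t\<close> eventually
  \<open>max s (\<tau> n) = s\<close>. They are bounded by a multiple of \<open>sup\<^sub>n V (\<tau> n, \<xi> n)\<close>, which is finite.
\<close>

lemma tendsto_time_integral:
  fixes h :: "real \<times> 'a \<Rightarrow> real"
  assumes h: "admissible h" and t: "t \<in> {0..T}" and x: "x \<in> S"
    and \<tau>: "\<And>n. \<tau> n \<in> {0..T}" and \<xi>: "\<And>n. \<xi> n \<in> S" and lim: "\<tau> \<longlonglongrightarrow> t" "\<xi> \<longlonglongrightarrow> x"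
  shows "(\<lambda>n. LBINT s:{\<tau> n..T}. expectation (\<lambda>\<omega>. h (s, X (\<tau> n) (\<xi> n) s \<omega>)))
    \<longlonglongrightarrow> (LBINT s:{t..T}. expectation (\<lambda>\<omega>. h (s, X t x s \<omega>)))"
proof -
  have hc: "continuous_on ({0..T} \<times> S) h" and growth: "sublinear h"
    using h by (auto simp: admissible_def)
  obtain a where a: "0 \<le> a" "\<And>t x. t \<in> {0..T} \<Longrightarrow> x \<in> S \<Longrightarrow> \<bar>h (t, x)\<bar> \<le> a * V (t, x)"
    using sublinear_imp_bounded[OF growth] by blast
  have "(\<lambda>n. V (\<tau> n, \<xi> n)) \<longlonglongrightarrow> V (t, x)"
    using t x \<tau> \<xi> by (intro continuous_on_tendsto_compose[OF V_continuous] tendsto_Pair lim) auto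
  then have "Bseq (\<lambda>n. V (\<tau> n, \<xi> n))"
    by (intro convergent_imp_Bseq convergentI)
  then obtain W where W: "0 < W" "\<And>n. norm (V (\<tau> n, \<xi> n)) \<le> W"
    by (auto simp: Bseq_def)
  let ?E = "\<lambda>t x s. expectation (\<lambda>\<omega>. h (s, X t x s \<omega>))"
  have slice: "\<bar>?E (\<tau> n) (\<xi> n) s\<bar> \<le> a * W" if s: "s \<in> {\<tau> n..T}" for n s
  proof -
    have s': "s \<in> {0..T}" using s \<tau>[of n] by auto
    have "\<bar>?E (\<tau> n) (\<xi> n) s\<bar> \<le> 0 + a * V (\<tau> n, \<xi> n)"
      by (rule expectation_bound[OF \<tau> \<xi> s continuous_on_slice[OF hc s'] order_refl a(1)])
        (use a(2)[OF s'] in simp)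
    also have "\<dots> \<le> a * W"
      using W(2)[of n] a(1) by (simp add: mult_left_mono)
    finally show ?thesis .
  qed
  show ?thesis
    unfolding set_lebesgue_integral_def
  proof (rule integral_dominated_convergence[where w = "\<lambda>s. indicator {0..T} s * (a * W)"])
    show "(\<lambda>s. indicat_real {t..T} s *\<^sub>R ?E t x s) \<in> borel_measurable lborel"
      using path_integral_Fubini(3)[OF h t x] by (simp add: set_integrable_def)
    show "(\<lambda>s. indicat_real {\<tau> n..T} s *\<^sub>R ?E (\<tau> n) (\<xi> n) s) \<in> borel_measurable lborel" for n
      using path_integral_Fubini(3)[OF h \<tau> \<xi>] by (simp add: set_integrable_def)
    show "integrable lborel (\<lambda>s. indicator {0..T} s * (a * W))"
      by (intro integrable_mult_left integrable_real_indicator) (auto simp: emeasure_lborel_Icc_eq)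
    show "AE s in lborel. norm (indicat_real {\<tau> n..T} s *\<^sub>R ?E (\<tau> n) (\<xi> n) s) \<le> indicator {0..T} s * (a * W)" for n
      using slice[of _ n] \<tau>[of n] a(1) W(1) by (intro AE_I2) (auto simp: indicator_def)
    have "AE s in lborel. s \<noteq> t"
      by (rule AE_lborel_singleton)
    then show "AE s in lborel. (\<lambda>n. indicat_real {\<tau> n..T} s *\<^sub>R ?E (\<tau> n) (\<xi> n) s) \<longlonglongrightarrow> indicat_real {t..T} s *\<^sub>R ?E t x s"
    proof eventually_elim
      case (elim s)
      consider "s < t" | "T < s" | "t < s" "s \<le> T" using elim by linarith
      then show ?case
      proof cases
        case 1
        then have "eventually (\<lambda>n. s < \<tau> n) sequentially"
          using lim(1) by (intro order_tendstoD)
        then have "eventually (\<lambda>n. 0 = indicat_real {\<tau> n..T} s *\<^sub>R ?E (\<tau> n) (\<xi> n) s) sequentially"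
          by eventually_elim simp
        with tendsto_const have "(\<lambda>n. indicat_real {\<tau> n..T} s *\<^sub>R ?E (\<tau> n) (\<xi> n) s) \<longlonglongrightarrow> 0"
          by (rule Lim_transform_eventually)
        with 1 show ?thesis by simp
      next
        case 3
        have s: "s \<in> {0..T}" using 3 t by auto
        have "\<exists>C\<ge>0. \<forall>r\<in>{s..T}. \<forall>y\<in>S. \<bar>h (r, y)\<bar> \<le> C + e * V (r, y)" if e: "0 < e" for e
        proof -
          obtain C where "C \<ge> 0" "\<And>r y. r \<in> {0..T} \<Longrightarrow> y \<in> S \<Longrightarrow> \<bar>h (r, y)\<bar> \<le> C + e * V (r, y)"
            using sublinearE[OF growth e] by metis
          with s show ?thesis by (intro exI[of _ C]) auto
        qed
        from tendsto_expectation[OF hc this s t x \<tau> \<xi> lim]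
        have lim': "(\<lambda>n. ?E (\<tau> n) (\<xi> n) (max s (\<tau> n))) \<longlonglongrightarrow> ?E t x (max s t)"
          by simp
        have "eventually (\<lambda>n. \<tau> n < s) sequentially"
          using lim(1) 3 by (intro order_tendstoD)
        then have "eventually (\<lambda>n. ?E (\<tau> n) (\<xi> n) (max s (\<tau> n)) = indicat_real {\<tau> n..T} s *\<^sub>R ?E (\<tau> n) (\<xi> n) s) sequentially"
          by eventually_elim (use 3 in \<open>simp add: max_def\<close>)
        from Lim_transform_eventually[OF lim' this] show ?thesis
          using 3 by (simp add: max_def)
      qed simp
    qed
  qed
qed

end

text \<open>
  From left to right, \<open>C\<close> is at most \<open>(e / 2) * V\<close> off a compact set because \<open>V\<close> is coercive. From
  right to left, \<open>h\<close> is bounded on \<open>{0..T} \<times> K\<close>.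
\<close>

lemma (in controlled_process) sublinear_iff_vanishing:
  assumes coercive: "\<And>B. \<exists>K. compact K \<and> K \<subseteq> S \<and> (\<forall>t\<in>{0..T}. \<forall>x\<in>S - K. B \<le> V (t, x))"
    and h: "continuous_on ({0..T} \<times> S) h"
  shows "sublinear h \<longleftrightarrow>
    (\<forall>e>0. \<exists>K. compact K \<and> K \<subseteq> S \<and> (\<forall>t\<in>{0..T}. \<forall>x\<in>S - K. \<bar>h (t, x)\<bar> \<le> e * V (t, x)))"
    (is "_ \<longleftrightarrow> ?vanish")
proof
  assume "sublinear h"
  show ?vanish
  proof (intro allI impI)
    fix e :: real assume e: "0 < e"
    then obtain C where C: "0 \<le> C"
      "\<And>t x. t \<in> {0..T} \<Longrightarrow> x \<in> S \<Longrightarrow> \<bar>h (t, x)\<bar> \<le> C + e / 2 * V (t, x)"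
      using sublinearE[OF \<open>sublinear h\<close>] by (metis half_gt_zero)
    obtain K where K: "compact K" "K \<subseteq> S" "\<And>t x. t \<in> {0..T} \<Longrightarrow> x \<in> S - K \<Longrightarrow> 2 * C / e \<le> V (t, x)"
      using coercive[of "2 * C / e"] by blast
    have "\<bar>h (t, x)\<bar> \<le> e * V (t, x)" if tx: "t \<in> {0..T}" "x \<in> S - K" for t x
    proof -
      have "C \<le> e / 2 * V (t, x)" using K(3)[OF tx] e by (simp add: field_simps)
      moreover have "\<bar>h (t, x)\<bar> \<le> C + e / 2 * V (t, x)" using C(2) tx by blast
      ultimately show ?thesis by (simp add: field_simps)
    qed
    with K show "\<exists>K. compact K \<and> K \<subseteq> S \<and> (\<forall>t\<in>{0..T}. \<forall>x\<in>S - K. \<bar>h (t, x)\<bar> \<le> e * V (t, x))"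
      by blast
  qed
next
  assume vanish: ?vanish
  show "sublinear h"
    unfolding sublinear_def
  proof (intro allI impI)
    fix e :: real assume e: "0 < e"
    from vanish[rule_format, OF e] obtain K where K: "compact K" "K \<subseteq> S"
      "\<And>t x. t \<in> {0..T} \<Longrightarrow> x \<in> S - K \<Longrightarrow> \<bar>h (t, x)\<bar> \<le> e * V (t, x)"
      by blast
    show "\<exists>C\<ge>0. \<forall>t\<in>{0..T}. \<forall>x\<in>S. \<bar>h (t, x)\<bar> \<le> C + e * V (t, x)"
      by (rule bounded_off_compact[OF compact_Icc K(1,2) h]) (use e V_pos K(3) in \<open>simp_all add: less_imp_le\<close>)
  qed
qed

section \<open>The Picard map\<close>

text \<open>
  The data of the equation. The bound on \<open>g\<close> compares with \<open>V\<close> at the terminal time, as \<open>g\<close> is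
  evaluated at \<open>X t x T\<close>.
\<close>

locale semilinear_problem = controlled_process M T \<delta> S X V
  for M :: "'w measure" and T \<delta> :: real
    and S :: "'a::{metric_space, second_countable_topology} set" and X V +
  fixes L :: real and f :: "real \<times> 'a \<times> real \<Rightarrow> real" and g :: "'a \<Rightarrow> real"
  assumes T_nonneg: "0 \<le> T" and L_pos: "0 < L"
    and f_continuous: "continuous_on ({0..T} \<times> S \<times> UNIV) f"
    and f_Lipschitz: "\<And>t x v w. t \<in> {0..T} \<Longrightarrow> x \<in> S \<Longrightarrow> \<bar>f (t, x, v) - f (t, x, w)\<bar> \<le> L * \<bar>v - w\<bar>"
    and f_sublinear: "sublinear (\<lambda>(t, x). f (t, x, 0))"
    and g_continuous: "continuous_on S g"
    and g_sublinear: "\<And>e. 0 < e \<Longrightarrow> \<exists>C\<ge>0. \<forall>x\<in>S. \<bar>g x\<bar> \<le> C + e * V (T, x)"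
begin

definition nonlinearity :: "(real \<times> 'a \<Rightarrow> real) \<Rightarrow> real \<times> 'a \<Rightarrow> real" where
  "nonlinearity u p = f (fst p, snd p, u p)"

text \<open>
  The right-hand side of the fixed point equation with expectation and time integral exchanged, so
  that one-time expectations suffice to estimate it.
\<close>

definition picard :: "(real \<times> 'a \<Rightarrow> real) \<Rightarrow> real \<times> 'a \<Rightarrow> real" where
  "picard u = (\<lambda>(t, x). expectation (\<lambda>\<omega>. g (X t x T \<omega>))
    + (LBINT s:{t..T}. expectation (\<lambda>\<omega>. nonlinearity u (s, X t x s \<omega>))))"

lemma admissible_nonlinearity:
  assumes "admissible u"
  shows "admissible (nonlinearity u)"
  unfolding admissible_def
proof
  have "continuous_on ({0..T} \<times> S) (\<lambda>p. (fst p, snd p, u p))"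
    using assms by (auto simp: admissible_def intro!: continuous_intros)
  then show "continuous_on ({0..T} \<times> S) (nonlinearity u)"
    unfolding nonlinearity_def by (rule continuous_on_compose2[OF f_continuous]) auto
  show "sublinear (nonlinearity u)"
    unfolding sublinear_def
  proof (intro allI impI)
    fix e :: real assume e: "0 < e"
    obtain C where C: "0 \<le> C" "\<forall>t\<in>{0..T}. \<forall>x\<in>S. \<bar>f (t, x, 0)\<bar> \<le> C + e / 2 * V (t, x)"
      using sublinearE[OF f_sublinear, of "e / 2"] e by (metis case_prod_conv half_gt_zero)
    have "0 < e / (2 * L)" using e L_pos by simp
    then obtain D where D: "0 \<le> D" "\<forall>t\<in>{0..T}. \<forall>x\<in>S. \<bar>u (t, x)\<bar> \<le> D + e / (2 * L) * V (t, x)"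
      using assms sublinearE unfolding admissible_def by metis
    have "\<bar>nonlinearity u (t, x)\<bar> \<le> C + L * D + e * V (t, x)" if tx: "t \<in> {0..T}" "x \<in> S" for t x
    proof -
      have "\<bar>nonlinearity u (t, x)\<bar> \<le> \<bar>f (t, x, 0)\<bar> + L * \<bar>u (t, x)\<bar>"
        using f_Lipschitz[OF tx, of "u (t, x)" 0] by (simp add: nonlinearity_def)
      also have "\<dots> \<le> (C + e / 2 * V (t, x)) + L * (D + e / (2 * L) * V (t, x))"
        using C D tx L_pos by (intro add_mono mult_left_mono) auto
      also have "\<dots> = C + L * D + e * V (t, x)"
        using L_pos by (simp add: field_simps)
      finally show ?thesis .
    qed
    then show "\<exists>C\<ge>0. \<forall>t\<in>{0..T}. \<forall>x\<in>S. \<bar>nonlinearity u (t, x)\<bar> \<le> C + e * V (t, x)"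
      using C(1) D(1) L_pos by (intro exI[of _ "C + L * D"]) auto
  qed
qed

lemma terminal_bound:
  assumes "t \<in> {0..T}" "x \<in> S" "0 \<le> C" "0 \<le> e" "\<And>y. y \<in> S \<Longrightarrow> \<bar>g y\<bar> \<le> C + e * V (T, y)"
  shows "integrable M (\<lambda>\<omega>. g (X t x T \<omega>))"
    and "\<bar>expectation (\<lambda>\<omega>. g (X t x T \<omega>))\<bar> \<le> C + e * V (t, x)"
  using assms by (auto intro!: expectation_bound[OF assms(1,2) _ g_continuous assms(3,4,5)])

text \<open>
  Within the admissible class both integrability requirements are automatic.
\<close>

lemma solves_sfpe_iff_picard:
  assumes "admissible u"
  shows "solves_sfpe M T S X f g u \<longleftrightarrow> (\<forall>t\<in>{0..T}. \<forall>x\<in>S. u (t, x) = picard u (t, x))"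
  unfolding solves_sfpe_def
proof (intro ball_cong refl)
  fix t x assume tx: "t \<in> {0..T}" "x \<in> S"
  obtain C where "0 \<le> C" "\<forall>x\<in>S. \<bar>g x\<bar> \<le> C + 1 * V (T, x)"
    using g_sublinear[OF zero_less_one] by blast
  then have g: "integrable M (\<lambda>\<omega>. g (X t x T \<omega>))"
    by (intro terminal_bound(1)[OF tx, of C 1]) auto
  note F = path_integral_Fubini[OF admissible_nonlinearity[OF assms] tx, unfolded nonlinearity_def fst_conv snd_conv]
  show "((AE \<omega> in M. set_integrable lborel {t..T} (\<lambda>s. f (s, X t x s \<omega>, u (s, X t x s \<omega>)))) \<and>
        integrable M (\<lambda>\<omega>. g (X t x T \<omega>) + (LBINT s:{t..T}. f (s, X t x s \<omega>, u (s, X t x s \<omega>)))) \<and>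
        u (t, x) = (LINT \<omega>|M. g (X t x T \<omega>) + (LBINT s:{t..T}. f (s, X t x s \<omega>, u (s, X t x s \<omega>)))))
     \<longleftrightarrow> u (t, x) = picard u (t, x)"
    using F(1,2,4) g by (simp add: picard_def nonlinearity_def)
qed

text \<open>
  Continuity combines the convergence of the terminal term at time \<open>T\<close> with that of the time
  integral. For the growth bound with slope \<open>e\<close>, the terminal term contributes one unit and the time
  integral at most \<open>T\<close> units of slope, whence the choice \<open>\<eta> = e / (1 + T)\<close>.
\<close>

lemma admissible_picard:
  assumes "admissible u"
  shows "admissible (picard u)"
  unfolding admissible_def
proof
  note h = admissible_nonlinearity[OF assms]
  show "continuous_on ({0..T} \<times> S) (picard u)"
    unfolding continuous_on_sequentially
  proof (intro allI ballI impI, elim conjE)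
    fix q p assume p: "p \<in> {0..T} \<times> S" and q: "\<forall>n. q n \<in> {0..T} \<times> S" and lim: "q \<longlonglongrightarrow> p"
    obtain t x where p_eq: "p = (t, x)" by (cases p)
    define \<tau> \<xi> where "\<tau> n = fst (q n)" and "\<xi> n = snd (q n)" for n
    have \<tau>: "\<tau> n \<in> {0..T}" and \<xi>: "\<xi> n \<in> S" for n
      using q by (auto simp: \<tau>_def \<xi>_def mem_Times_iff)
    have lim': "\<tau> \<longlonglongrightarrow> t" "\<xi> \<longlonglongrightarrow> x"
      using tendsto_fst[OF lim] tendsto_snd[OF lim] by (simp_all add: p_eq \<tau>_def[abs_def] \<xi>_def[abs_def])
    have tx: "t \<in> {0..T}" "x \<in> S" using p p_eq by auto
    have "continuous_on ({0..T} \<times> S) (\<lambda>p. g (snd p))"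
      by (rule continuous_on_compose2[OF g_continuous]) (auto intro!: continuous_intros)
    then have "(\<lambda>n. expectation (\<lambda>\<omega>. g (snd (max T (\<tau> n), X (\<tau> n) (\<xi> n) (max T (\<tau> n)) \<omega>))))
        \<longlonglongrightarrow> expectation (\<lambda>\<omega>. g (snd (max T t, X t x (max T t) \<omega>)))"
      using g_sublinear T_nonneg by (intro tendsto_expectation tx \<tau> \<xi> lim') auto
    moreover have "max T (\<tau> n) = T" "max T t = T" for n
      using \<tau>[of n] tx by auto
    ultimately have "(\<lambda>n. expectation (\<lambda>\<omega>. g (X (\<tau> n) (\<xi> n) T \<omega>))) \<longlonglongrightarrow> expectation (\<lambda>\<omega>. g (X t x T \<omega>))"
      by simp
    then have "(\<lambda>n. picard u (\<tau> n, \<xi> n)) \<longlonglongrightarrow> picard u (t, x)"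
      unfolding picard_def split_conv
      by (intro tendsto_add tendsto_time_integral h tx \<tau> \<xi> lim')
    then show "(picard u \<circ> q) \<longlonglongrightarrow> picard u p"
      by (simp add: o_def p_eq \<tau>_def \<xi>_def)
  qed
  show "sublinear (picard u)"
    unfolding sublinear_def
  proof (intro allI impI)
    fix e :: real assume e: "0 < e"
    define \<eta> where "\<eta> = e / (1 + T)"
    have "0 < \<eta>" "\<eta> * (1 + T) = e" using e T_nonneg by (auto simp: \<eta>_def)
    then have \<eta>: "0 < \<eta>" "\<eta> + T * \<eta> = e" by (simp_all add: algebra_simps)
    obtain C where C: "0 \<le> C" "\<forall>x\<in>S. \<bar>g x\<bar> \<le> C + \<eta> * V (T, x)"
      using g_sublinear[OF \<eta>(1)] by blast
    obtain D where D: "0 \<le> D" "\<forall>t\<in>{0..T}. \<forall>x\<in>S. \<bar>nonlinearity u (t, x)\<bar> \<le> D + \<eta> * V (t, x)"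
      using h \<eta>(1) sublinearE unfolding admissible_def by metis
    have "\<bar>picard u (t, x)\<bar> \<le> C + T * D + e * V (t, x)" if tx: "t \<in> {0..T}" "x \<in> S" for t x
    proof -
      have slice: "\<bar>expectation (\<lambda>\<omega>. nonlinearity u (s, X t x s \<omega>))\<bar> \<le> D + \<eta> * V (t, x)"
        if s: "s \<in> {t..T}" for s
      proof (rule expectation_bound[OF tx s _ D(1)])
        show "continuous_on S (\<lambda>y. nonlinearity u (s, y))"
          using h s tx by (intro continuous_on_slice) (auto simp: admissible_def)
      qed (use s tx D \<eta> in auto)
      have "\<bar>LBINT s:{t..T}. expectation (\<lambda>\<omega>. nonlinearity u (s, X t x s \<omega>))\<bar> \<le> T * (D + \<eta> * V (t, x))"
        using D(1) \<eta>(1) V_pos[OF tx] by (intro time_integral_bound tx path_integral_Fubini h slice) auto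
      moreover have "\<bar>expectation (\<lambda>\<omega>. g (X t x T \<omega>))\<bar> \<le> C + \<eta> * V (t, x)"
        using C \<eta>(1) by (intro terminal_bound tx) auto
      ultimately have "\<bar>picard u (t, x)\<bar> \<le> C + \<eta> * V (t, x) + T * (D + \<eta> * V (t, x))"
        unfolding picard_def by simp
      also have "\<dots> = C + T * D + (\<eta> + T * \<eta>) * V (t, x)" by (simp add: algebra_simps)
      finally show ?thesis by (simp add: \<eta>(2))
    qed
    then show "\<exists>C\<ge>0. \<forall>t\<in>{0..T}. \<forall>x\<in>S. \<bar>picard u (t, x)\<bar> \<le> C + e * V (t, x)"
      using C(1) D(1) T_nonneg by (intro exI[of _ "C + T * D"]) auto
  qed
qed

text \<open>
  The weight \<open>e\<^sup>-\<^sup>2\<^sup>L\<^sup>t\<close> makes the map a contraction on the whole interval \<open>{0..T}\<close>: integrating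
  \<open>L * e\<^sup>-\<^sup>2\<^sup>L\<^sup>s\<close> from \<open>t\<close> on gives at most half the weight at \<open>t\<close>.
\<close>

lemma picard_contraction:
  assumes u: "admissible u" and v: "admissible v" and A: "0 \<le> A"
    and close: "\<And>t x. t \<in> {0..T} \<Longrightarrow> x \<in> S \<Longrightarrow> \<bar>u (t, x) - v (t, x)\<bar> \<le> A * exp (- 2 * L * t) * V (t, x)"
    and tx: "t \<in> {0..T}" "x \<in> S"
  shows "\<bar>picard u (t, x) - picard v (t, x)\<bar> \<le> A / 2 * exp (- 2 * L * t) * V (t, x)"
proof -
  let ?Eu = "\<lambda>s. expectation (\<lambda>\<omega>. nonlinearity u (s, X t x s \<omega>))"
  let ?Ev = "\<lambda>s. expectation (\<lambda>\<omega>. nonlinearity v (s, X t x s \<omega>))"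
  note hu = admissible_nonlinearity[OF u] and hv = admissible_nonlinearity[OF v]
  have slice: "\<bar>?Eu s - ?Ev s\<bar> \<le> L * A * V (t, x) * exp (- 2 * L * s)" if s: "s \<in> {t..T}" for s
  proof -
    have s': "s \<in> {0..T}" using s tx by auto
    have uc: "continuous_on S (\<lambda>y. nonlinearity u (s, y))" and vc: "continuous_on S (\<lambda>y. nonlinearity v (s, y))"
      using hu hv by (auto intro!: continuous_on_slice[OF _ s'] simp: admissible_def)
    have int: "integrable M (\<lambda>\<omega>. nonlinearity w (s, X t x s \<omega>))"
      if w: "admissible (nonlinearity w)" for w
    proof -
      obtain a where "0 \<le> a" "\<And>t x. t \<in> {0..T} \<Longrightarrow> x \<in> S \<Longrightarrow> \<bar>nonlinearity w (t, x)\<bar> \<le> a * V (t, x)"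
        using w sublinear_imp_bounded unfolding admissible_def by blast
      then show ?thesis
        using w s' by (intro expectation_bound(1)[OF tx s continuous_on_slice[OF _ s'] order_refl, of _ a])
          (auto simp: admissible_def)
    qed
    have "\<bar>expectation (\<lambda>\<omega>. nonlinearity u (s, X t x s \<omega>) - nonlinearity v (s, X t x s \<omega>))\<bar>
        \<le> 0 + (L * (A * exp (- 2 * L * s))) * V (t, x)"
    proof (rule expectation_bound[OF tx s continuous_on_diff[OF uc vc] order_refl])
      fix y assume y: "y \<in> S"
      have "\<bar>nonlinearity u (s, y) - nonlinearity v (s, y)\<bar> \<le> L * \<bar>u (s, y) - v (s, y)\<bar>"
        using f_Lipschitz[OF s' y] by (simp add: nonlinearity_def)
      also have "\<dots> \<le> L * (A * exp (- 2 * L * s) * V (s, y))"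
        using L_pos close[OF s' y] by (intro mult_left_mono) auto
      finally show "\<bar>nonlinearity u (s, y) - nonlinearity v (s, y)\<bar> \<le> 0 + L * (A * exp (- 2 * L * s)) * V (s, y)"
        by (simp add: mult.assoc)
    qed (use L_pos A in auto)
    then show ?thesis
      using int[OF hu] int[OF hv] by (simp add: mult_ac)
  qed
  have FTC: "has_bochner_integral lborel (\<lambda>s. exp (- 2 * L * s) * indicator {t..T} s)
      (- exp (- 2 * L * T) / (2 * L) - - exp (- 2 * L * t) / (2 * L))"
    using tx L_pos
    by (intro has_bochner_integral_FTC_Icc_real) (auto intro!: derivative_eq_intros continuous_intros)
  have int_diff: "set_integrable lborel {t..T} (\<lambda>s. ?Eu s - ?Ev s)"
    by (intro set_integral_diff path_integral_Fubini hu hv tx)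
  have "\<bar>picard u (t, x) - picard v (t, x)\<bar> = \<bar>LBINT s:{t..T}. ?Eu s - ?Ev s\<bar>"
    unfolding picard_def by (subst set_integral_diff) (auto intro!: path_integral_Fubini hu hv tx)
  also have "\<dots> \<le> (\<integral>s. L * A * V (t, x) * (exp (- 2 * L * s) * indicator {t..T} s) \<partial>lborel)"
    unfolding set_lebesgue_integral_def
  proof (intro Bochner_Integration.integral_abs_bound_integral)
    show "integrable lborel (\<lambda>s. indicat_real {t..T} s *\<^sub>R (?Eu s - ?Ev s))"
      using int_diff by (simp add: set_integrable_def)
    show "integrable lborel (\<lambda>s. L * A * V (t, x) * (exp (- 2 * L * s) * indicator {t..T} s))"
      using FTC by (intro integrable_mult_right) (auto simp: has_bochner_integral_iff)
    show "\<bar>indicat_real {t..T} s *\<^sub>R (?Eu s - ?Ev s)\<bar> \<le> L * A * V (t, x) * (exp (- 2 * L * s) * indicator {t..T} s)" for s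
      using slice[of s] by (auto simp: indicator_def)
  qed
  also have "\<dots> = L * A * V (t, x) * ((exp (- 2 * L * t) - exp (- 2 * L * T)) / (2 * L))"
    using FTC by (simp add: has_bochner_integral_iff diff_divide_distrib)
  also have "\<dots> \<le> L * A * V (t, x) * (exp (- 2 * L * t) / (2 * L))"
    using L_pos A V_pos[OF tx] by (intro mult_left_mono divide_right_mono) auto
  also have "\<dots> = A / 2 * exp (- 2 * L * t) * V (t, x)"
    using L_pos by (simp add: field_simps)
  finally show ?thesis .
qed

text \<open>
  Any two admissible functions have finite weighted distance. This starts the iteration of the
  contraction.
\<close>

lemma sublinear_weighted_bound:
  assumes "sublinear h"
  obtains A where "0 \<le> A" "\<And>t x. t \<in> {0..T} \<Longrightarrow> x \<in> S \<Longrightarrow> \<bar>h (t, x)\<bar> \<le> A * exp (- 2 * L * t) * V (t, x)"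
proof -
  obtain a where a: "0 \<le> a" "\<And>t x. t \<in> {0..T} \<Longrightarrow> x \<in> S \<Longrightarrow> \<bar>h (t, x)\<bar> \<le> a * V (t, x)"
    using sublinear_imp_bounded[OF assms] by blast
  show thesis
  proof (rule that[of "a * exp (2 * L * T)"])
    fix t x assume tx: "t \<in> {0..T}" "x \<in> S"
    have "1 \<le> exp (2 * L * T) * exp (- 2 * L * t)"
      using tx L_pos by (simp add: exp_add[symmetric])
    then have "a * V (t, x) * 1 \<le> a * V (t, x) * (exp (2 * L * T) * exp (- 2 * L * t))"
      using a(1) V_pos[OF tx] by (intro mult_left_mono) auto
    with a(2)[OF tx] show "\<bar>h (t, x)\<bar> \<le> a * exp (2 * L * T) * exp (- 2 * L * t) * V (t, x)"
      by (simp add: mult_ac)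
  qed (use a in simp)
qed

lemma sublinear_diff:
  assumes "sublinear u" "sublinear v"
  shows "sublinear (\<lambda>p. u p - v p)"
  unfolding sublinear_def
proof (intro allI impI)
  fix e :: real assume "0 < e"
  then have e: "0 < e / 2" by simp
  obtain C where C: "0 \<le> C" "\<forall>t\<in>{0..T}. \<forall>x\<in>S. \<bar>u (t, x)\<bar> \<le> C + e / 2 * V (t, x)"
    using sublinearE[OF assms(1) e] by metis
  obtain D where D: "0 \<le> D" "\<forall>t\<in>{0..T}. \<forall>x\<in>S. \<bar>v (t, x)\<bar> \<le> D + e / 2 * V (t, x)"
    using sublinearE[OF assms(2) e] by metis
  have "\<bar>u (t, x) - v (t, x)\<bar> \<le> C + D + e * V (t, x)" if "t \<in> {0..T}" "x \<in> S" for t x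
  proof -
    have "\<bar>u (t, x)\<bar> \<le> C + e / 2 * V (t, x)" "\<bar>v (t, x)\<bar> \<le> D + e / 2 * V (t, x)"
      using C D that by auto
    then show ?thesis by (simp add: abs_le_iff)
  qed
  then show "\<exists>C\<ge>0. \<forall>t\<in>{0..T}. \<forall>x\<in>S. \<bar>u (t, x) - v (t, x)\<bar> \<le> C + e * V (t, x)"
    using C(1) D(1) by (intro exI[of _ "C + D"]) auto
qed

lemma picard_fixed_point_unique:
  assumes u: "admissible u" "\<And>t x. t \<in> {0..T} \<Longrightarrow> x \<in> S \<Longrightarrow> u (t, x) = picard u (t, x)"
    and v: "admissible v" "\<And>t x. t \<in> {0..T} \<Longrightarrow> x \<in> S \<Longrightarrow> v (t, x) = picard v (t, x)"
    and tx: "t \<in> {0..T}" "x \<in> S"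
  shows "u (t, x) = v (t, x)"
proof -
  obtain A where A: "0 \<le> A"
    "\<And>t x. t \<in> {0..T} \<Longrightarrow> x \<in> S \<Longrightarrow> \<bar>u (t, x) - v (t, x)\<bar> \<le> A * exp (- 2 * L * t) * V (t, x)"
    using sublinear_weighted_bound[OF sublinear_diff[of u v]] u(1) v(1) unfolding admissible_def by blast
  have step: "\<bar>u (t, x) - v (t, x)\<bar> \<le> A * (1/2) ^ n * exp (- 2 * L * t) * V (t, x)"
    if "t \<in> {0..T}" "x \<in> S" for n t x
    using that
  proof (induction n arbitrary: t x)
    case (Suc n)
    have "\<bar>picard u (t, x) - picard v (t, x)\<bar> \<le> A * (1/2) ^ n / 2 * exp (- 2 * L * t) * V (t, x)"
      by (rule picard_contraction[OF u(1) v(1)]) (use A(1) Suc in auto)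
    with u(2)[OF Suc.prems] v(2)[OF Suc.prems] show ?case by simp
  qed (use A in simp)
  have "(\<lambda>n. A * (1/2) ^ n * exp (- 2 * L * t) * V (t, x)) \<longlonglongrightarrow> A * 0 * exp (- 2 * L * t) * V (t, x)"
    by (intro tendsto_intros LIMSEQ_realpow_zero) auto
  then have "\<bar>u (t, x) - v (t, x)\<bar> \<le> A * 0 * exp (- 2 * L * t) * V (t, x)"
    by (rule LIMSEQ_le_const) (use step[OF tx] in auto)
  then show ?thesis by simp
qed

text \<open>
  Completeness of the admissible class: convergence relative to \<open>V\<close> preserves continuity, and an
  approximation up to \<open>(e / 2) * V\<close> costs half of the allowed slope.
\<close>

lemma admissible_uniform_limit:
  assumes u: "\<And>n. admissible (u n)"
    and lim: "uniform_limit ({0..T} \<times> S) (\<lambda>n p. u n p / V p) w sequentially"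
  shows "admissible (\<lambda>p. w p * V p)"
  unfolding admissible_def
proof
  have "continuous_on ({0..T} \<times> S) w"
  proof (rule uniform_limit_theorem[OF _ lim])
    show "\<forall>\<^sub>F n in sequentially. continuous_on ({0..T} \<times> S) (\<lambda>p. u n p / V p)"
      using u V_pos by (intro always_eventually allI continuous_on_divide V_continuous)
        (force simp: admissible_def)+
  qed simp
  then show "continuous_on ({0..T} \<times> S) (\<lambda>p. w p * V p)"
    by (intro continuous_intros V_continuous)
  show "sublinear (\<lambda>p. w p * V p)"
    unfolding sublinear_def
  proof (intro allI impI)
    fix e :: real assume "0 < e"
    then have e: "0 < e / 2" by simp
    obtain n where n: "\<forall>p\<in>{0..T} \<times> S. dist (u n p / V p) (w p) < e / 2"
      using uniform_limitD[OF lim e] by (auto simp: eventually_sequentially)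
    obtain C where C: "0 \<le> C" "\<forall>t\<in>{0..T}. \<forall>x\<in>S. \<bar>u n (t, x)\<bar> \<le> C + e / 2 * V (t, x)"
      using u[of n] e sublinearE unfolding admissible_def by metis
    have "\<bar>w (t, x) * V (t, x)\<bar> \<le> C + e * V (t, x)" if tx: "t \<in> {0..T}" "x \<in> S" for t x
    proof -
      have "\<bar>u n (t, x) / V (t, x) - w (t, x)\<bar> < e / 2"
        unfolding dist_real_def[symmetric] using n tx by blast
      then have "\<bar>w (t, x)\<bar> \<le> \<bar>u n (t, x) / V (t, x)\<bar> + e / 2"
        by linarith
      then have "\<bar>w (t, x)\<bar> * V (t, x) \<le> (\<bar>u n (t, x)\<bar> / V (t, x) + e / 2) * V (t, x)"
        using V_pos[OF tx] by (intro mult_right_mono) (auto simp: abs_divide)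
      also have "\<dots> = \<bar>u n (t, x)\<bar> + e / 2 * V (t, x)"
        using V_pos[OF tx] by (simp add: field_simps)
      finally show ?thesis
        using C(2)[rule_format, OF tx] V_pos[OF tx] by (simp add: abs_mult)
    qed
    then show "\<exists>C\<ge>0. \<forall>t\<in>{0..T}. \<forall>x\<in>S. \<bar>w (t, x) * V (t, x)\<bar> \<le> C + e * V (t, x)"
      using C(1) by blast
  qed
qed

lemma admissible_cong:
  assumes "\<And>p. p \<in> {0..T} \<times> S \<Longrightarrow> u p = v p"
  shows "admissible u \<longleftrightarrow> admissible v"
proof -
  have "continuous_on ({0..T} \<times> S) u \<longleftrightarrow> continuous_on ({0..T} \<times> S) v"
    using assms by (intro continuous_on_cong) auto
  then show ?thesis
    using assms by (simp add: admissible_def sublinear_def)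
qed

text \<open>
  The increments of the Picard iteration shrink geometrically relative to \<open>V\<close>, so the Weierstrass
  test yields a limit. The limit is a fixed point because it and its image under \<open>picard\<close> are both
  close to a late iterate. It is set to the default value \<open>undefined\<close> outside \<open>{0..T} \<times> S\<close>.
\<close>

lemma picard_fixed_point_exists:
  obtains u where "u \<in> extensional ({0..T} \<times> S)" "admissible u"
    "\<And>t x. t \<in> {0..T} \<Longrightarrow> x \<in> S \<Longrightarrow> u (t, x) = picard u (t, x)"
proof -
  define U where "U n = (picard ^^ n) (\<lambda>_. 0)" for n
  have U_Suc: "U (Suc n) = picard (U n)" for n by (simp add: U_def)
  have U: "admissible (U n)" for n
  proof (induction n)
    case 0
    have "sublinear (\<lambda>_. 0)"
      unfolding sublinear_def using V_pos by (intro allI impI exI[of _ 0]) (simp add: less_imp_le)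
    then show ?case by (simp add: U_def admissible_def)
  qed (simp add: U_Suc admissible_picard)
  obtain A where A: "0 \<le> A"
    "\<And>t x. t \<in> {0..T} \<Longrightarrow> x \<in> S \<Longrightarrow> \<bar>U 1 (t, x) - U 0 (t, x)\<bar> \<le> A * exp (- 2 * L * t) * V (t, x)"
    using sublinear_weighted_bound[OF sublinear_diff[of "U 1" "U 0"]] U unfolding admissible_def by blast
  have step: "\<bar>U (Suc n) (t, x) - U n (t, x)\<bar> \<le> A * (1/2) ^ n * exp (- 2 * L * t) * V (t, x)"
    if "t \<in> {0..T}" "x \<in> S" for n t x
    using that
  proof (induction n arbitrary: t x)
    case (Suc n)
    have "\<bar>picard (U (Suc n)) (t, x) - picard (U n) (t, x)\<bar> \<le> A * (1/2) ^ n / 2 * exp (- 2 * L * t) * V (t, x)"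
      by (rule picard_contraction[OF U U]) (use A(1) Suc in auto)
    then show ?case by (simp add: U_Suc)
  qed (use A in simp)
  have term_le: "norm ((U (Suc n) p - U n p) / V p) \<le> A * (1/2) ^ n" if p_in: "p \<in> {0..T} \<times> S" for n p
  proof -
    obtain t x where p: "p = (t, x)" and tx: "t \<in> {0..T}" "x \<in> S" using p_in by (cases p) auto
    have "A * (1/2) ^ n * exp (- 2 * L * t) * V (t, x) \<le> A * (1/2) ^ n * 1 * V (t, x)"
      using A(1) L_pos tx V_pos[OF tx] by (intro mult_right_mono mult_left_mono) auto
    with step[OF tx, of n] show ?thesis
      using V_pos[OF tx] by (simp add: p abs_divide divide_le_eq)
  qed
  have "uniform_limit ({0..T} \<times> S) (\<lambda>n p. \<Sum>k<n. (U (Suc k) p - U k p) / V p)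
      (\<lambda>p. \<Sum>k. (U (Suc k) p - U k p) / V p) sequentially"
    by (rule Weierstrass_m_test[OF term_le]) (auto intro!: summable_mult summable_geometric)
  moreover have "(\<Sum>k<n. (U (Suc k) p - U k p) / V p) = U n p / V p" for n p
    unfolding sum_divide_distrib[symmetric] sum_lessThan_telescope[of "\<lambda>k. U k p"] by (simp add: U_def)
  ultimately obtain w where lim: "uniform_limit ({0..T} \<times> S) (\<lambda>n p. U n p / V p) w sequentially"
    by auto
  define u where "u = restrict (\<lambda>p. w p * V p) ({0..T} \<times> S)"
  have u: "admissible u"
    using admissible_uniform_limit[OF U lim] by (subst admissible_cong) (auto simp: u_def)
  have "u (t, x) = picard u (t, x)" if tx: "t \<in> {0..T}" "x \<in> S" for t x
  proof -
    have "\<bar>u (t, x) - picard u (t, x)\<bar> \<le> e" if e: "0 < e" for e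
    proof -
      (* Both u - U (n0 + 1) and picard u - picard (U n0) must be estimated at (t, x), the latter
         through the weighted distance, which loses at most the factor exp (2 * L * T). *)
      define \<eta> where "\<eta> = e / ((1 + exp (2 * L * T)) * V (t, x))"
      have pos: "0 < (1 + exp (2 * L * T)) * V (t, x)"
        using V_pos[OF tx] by (simp add: add_pos_pos)
      have \<eta>: "0 < \<eta>" "\<eta> * ((1 + exp (2 * L * T)) * V (t, x)) = e"
        using e pos by (auto simp: \<eta>_def)
      obtain n0 where n0: "\<And>n p. n0 \<le> n \<Longrightarrow> p \<in> {0..T} \<times> S \<Longrightarrow> dist (U n p / V p) (w p) < \<eta>"
        using uniform_limitD[OF lim \<eta>(1)] by (auto simp: eventually_sequentially)
      have near: "\<bar>u (s, y) - U n (s, y)\<bar> \<le> \<eta> * V (s, y)" if "n0 \<le> n" "s \<in> {0..T}" "y \<in> S" for n s y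
      proof -
        have "u (s, y) - U n (s, y) = (w (s, y) - U n (s, y) / V (s, y)) * V (s, y)"
          using that(2,3) V_pos[OF that(2,3)] by (simp add: u_def field_simps)
        then have "\<bar>u (s, y) - U n (s, y)\<bar> = dist (U n (s, y) / V (s, y)) (w (s, y)) * V (s, y)"
          using V_pos[OF that(2,3)] by (simp add: dist_real_def abs_mult abs_minus_commute)
        also have "\<dots> \<le> \<eta> * V (s, y)"
          using n0[OF that(1), of "(s, y)"] that V_pos[OF that(2,3)] by (intro mult_right_mono) auto
        finally show ?thesis .
      qed
      have "\<bar>picard u (t, x) - picard (U n0) (t, x)\<bar> \<le> \<eta> * exp (2 * L * T) / 2 * exp (- 2 * L * t) * V (t, x)"
      proof (rule picard_contraction[OF u U _ _ tx])
        fix s y assume sy: "s \<in> {0..T}" "y \<in> S"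
        have "1 \<le> exp (2 * L * T) * exp (- 2 * L * s)"
          using sy L_pos by (simp add: exp_add[symmetric])
        then have "\<eta> * V (s, y) * 1 \<le> \<eta> * V (s, y) * (exp (2 * L * T) * exp (- 2 * L * s))"
          using \<eta>(1) V_pos[OF sy] by (intro mult_left_mono) auto
        with near[OF order_refl sy]
        show "\<bar>u (s, y) - U n0 (s, y)\<bar> \<le> \<eta> * exp (2 * L * T) * exp (- 2 * L * s) * V (s, y)"
          by (simp add: mult_ac)
      qed (use \<eta>(1) in simp)
      also have "\<dots> \<le> \<eta> * exp (2 * L * T) * 1 * V (t, x)"
        using \<eta>(1) tx L_pos V_pos[OF tx] by (intro mult_right_mono mult_mono) auto
      finally have "\<bar>picard u (t, x) - U (Suc n0) (t, x)\<bar> \<le> \<eta> * exp (2 * L * T) * V (t, x)"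
        by (simp add: U_Suc)
      moreover have "\<bar>u (t, x) - U (Suc n0) (t, x)\<bar> \<le> \<eta> * V (t, x)"
        by (rule near[OF _ tx]) simp
      ultimately have "\<bar>u (t, x) - picard u (t, x)\<bar> \<le> \<eta> * V (t, x) + \<eta> * exp (2 * L * T) * V (t, x)"
        by linarith
      also have "\<dots> = e" using \<eta>(2) by (simp add: algebra_simps)
      finally show ?thesis .
    qed
    then have "\<bar>u (t, x) - picard u (t, x)\<bar> \<le> 0"
      by (rule field_le_epsilon[where y=0, simplified])
    then show ?thesis by simp
  qed
  moreover have "u \<in> extensional ({0..T} \<times> S)" by (simp add: u_def)
  ultimately show thesis using u by (intro that)
qed

end

section \<open>Existence and uniqueness\<close>

theorem theorem2p9:
  fixes L T :: real
    and nrm :: "real ^ 'd \<Rightarrow> real"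
    and \<O> :: "(real ^ 'd) set"
    and M :: "'w measure"
    and X :: "real \<Rightarrow> real ^ 'd \<Rightarrow> real \<Rightarrow> 'w \<Rightarrow> real ^ 'd"
    and f :: "real \<times> (real ^ 'd) \<times> real \<Rightarrow> real"
    and g :: "real ^ 'd \<Rightarrow> real"
    and V :: "real \<times> (real ^ 'd) \<Rightarrow> real"
  assumes "0 < L" and "0 < T"
    and "is_norm nrm"
    and "\<O> \<noteq> {}" and "open \<O>"
    and "prob_space M"
    and X_measurable: "\<And>t x. t \<in> {0..T} \<Longrightarrow> x \<in> \<O> \<Longrightarrow>
      (\<lambda>(s, \<omega>). X t x s \<omega>)
        \<in> restrict_space borel {t..T} \<Otimes>\<^sub>M M \<rightarrow>\<^sub>M restrict_space borel \<O>"
    and X_continuous: "\<And>\<epsilon> s (\<tau> :: nat \<Rightarrow> real) (\<xi> :: nat \<Rightarrow> real ^ 'd).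
      0 < \<epsilon> \<Longrightarrow> s \<in> {0..T} \<Longrightarrow> (\<And>n. \<tau> n \<in> {0..T}) \<Longrightarrow> (\<And>n. \<xi> n \<in> \<O>) \<Longrightarrow>
      limsup (\<lambda>n. ereal (\<bar>\<tau> n - \<tau> 0\<bar> + nrm (\<xi> n - \<xi> 0))) = 0 \<Longrightarrow>
      limsup (\<lambda>n. ereal (\<P>(\<omega> in M.
        nrm (X (\<tau> n) (\<xi> n) (max s (\<tau> n)) \<omega> - X (\<tau> 0) (\<xi> 0) (max s (\<tau> 0)) \<omega>) \<ge> \<epsilon>))) = 0"
    and "continuous_on ({0..T} \<times> \<O> \<times> UNIV) f"
    and "continuous_on \<O> g"
    and "continuous_on ({0..T} \<times> \<O>) V"
    and V_pos: "\<And>t x. t \<in> {0..T} \<Longrightarrow> x \<in> \<O> \<Longrightarrow> 0 < V (t, x)"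
    and V_supermartingale: "\<And>t s x. t \<in> {0..T} \<Longrightarrow> s \<in> {t..T} \<Longrightarrow> x \<in> \<O> \<Longrightarrow>
      (\<integral>\<^sup>+ \<omega>. ennreal (V (s, X t x s \<omega>)) \<partial>M) \<le> ennreal (V (t, x))"
    and f_Lipschitz: "\<And>t x v w. t \<in> {0..T} \<Longrightarrow> x \<in> \<O> \<Longrightarrow>
      \<bar>f (t, x, v) - f (t, x, w)\<bar> \<le> L * \<bar>v - w\<bar>"
    and "(INF r\<in>{0<..}. SUP t\<in>{0..T}. SUP x\<in>\<O> - inner_part nrm \<O> r.
      ereal (\<bar>f (t, x, 0)\<bar> / V (t, x) + \<bar>g x\<bar> / V (T, x))) = 0"
    and "(SUP r\<in>{0<..}. INF t\<in>{0..T}. INF x\<in>\<O> - inner_part nrm \<O> r. ereal (V (t, x))) = \<infinity>"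
  shows "\<exists>!u :: real \<times> (real ^ 'd) \<Rightarrow> real.
    u \<in> extensional ({0..T} \<times> \<O>) \<and>
    continuous_on ({0..T} \<times> \<O>) u \<and>
    Limsup at_top (\<lambda>r::real. SUP t\<in>{0..T}. SUP x\<in>\<O> - inner_part nrm \<O> r.
      ereal (\<bar>u (t, x)\<bar> / V (t, x))) = 0 \<and>
    solves_sfpe M T \<O> X f g u"
proof -
  have N: "is_norm nrm" and S: "\<O> \<noteq> {}" "open \<O>" and prob: "prob_space M"
    and f_cont: "continuous_on ({0..T} \<times> \<O> \<times> UNIV) f" and g_cont: "continuous_on \<O> g"
    and V_cont: "continuous_on ({0..T} \<times> \<O>) V" and L: "0 < L" and T: "0 < T"
    by fact+
  have fg: "(INF r\<in>{0<..}. SUP t\<in>{0..T}. SUP x\<in>\<O> - inner_part nrm \<O> r.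
      ereal (\<bar>f (t, x, 0)\<bar> / V (t, x) + \<bar>g x\<bar> / V (T, x))) = 0"
    and V_inf: "(SUP r\<in>{0<..}. INF t\<in>{0..T}. INF x\<in>\<O> - inner_part nrm \<O> r. ereal (V (t, x))) = \<infinity>"
    by fact+
  have sub: "inner_part nrm \<O> r \<subseteq> \<O>" for r by (auto simp: inner_part_def)
  have coercive: "\<exists>K. compact K \<and> K \<subseteq> \<O> \<and> (\<forall>t\<in>{0..T}. \<forall>x\<in>\<O> - K. B \<le> V (t, x))" for B
  proof -
    have "ereal B < (SUP r\<in>{0<..}. INF t\<in>{0..T}. INF x\<in>\<O> - inner_part nrm \<O> r. ereal (V (t, x)))"
      by (simp add: V_inf)
    then obtain r where r: "0 < r" "ereal B < (INF t\<in>{0..T}. INF x\<in>\<O> - inner_part nrm \<O> r. ereal (V (t, x)))"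
      by (auto simp: less_SUP_iff)
    from r(2) have "ereal B \<le> (INF t\<in>{0..T}. INF x\<in>\<O> - inner_part nrm \<O> r. ereal (V (t, x)))"
      by (rule less_imp_le)
    then have "\<forall>t\<in>{0..T}. \<forall>x\<in>\<O> - inner_part nrm \<O> r. B \<le> V (t, x)"
      by (simp add: le_INF_iff)
    with sub compact_inner_part[OF N r(1)] show ?thesis by blast
  qed
  have data: "\<exists>K. compact K \<and> K \<subseteq> \<O> \<and>
      (\<forall>t\<in>{0..T}. \<forall>x\<in>\<O> - K. \<bar>f (t, x, 0)\<bar> \<le> e * V (t, x) \<and> \<bar>g x\<bar> \<le> e * V (T, x))"
    if e: "0 < e" for e
  proof -
    have "(INF r\<in>{0<..}. SUP t\<in>{0..T}. SUP x\<in>\<O> - inner_part nrm \<O> r.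
      ereal (\<bar>f (t, x, 0)\<bar> / V (t, x) + \<bar>g x\<bar> / V (T, x))) < ereal e"
      using e by (simp add: fg)
    then obtain r where r: "0 < r" "(SUP t\<in>{0..T}. SUP x\<in>\<O> - inner_part nrm \<O> r.
      ereal (\<bar>f (t, x, 0)\<bar> / V (t, x) + \<bar>g x\<bar> / V (T, x))) < ereal e"
      by (auto simp: INF_less_iff)
    from r(2) have "(SUP t\<in>{0..T}. SUP x\<in>\<O> - inner_part nrm \<O> r.
      ereal (\<bar>f (t, x, 0)\<bar> / V (t, x) + \<bar>g x\<bar> / V (T, x))) \<le> ereal e"
      by (rule less_imp_le)
    then have le: "\<bar>f (t, x, 0)\<bar> / V (t, x) + \<bar>g x\<bar> / V (T, x) \<le> e"
      if "t \<in> {0..T}" "x \<in> \<O> - inner_part nrm \<O> r" for t x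
      using that by (simp add: SUP_le_iff)
    have "\<bar>f (t, x, 0)\<bar> \<le> e * V (t, x) \<and> \<bar>g x\<bar> \<le> e * V (T, x)"
      if tx: "t \<in> {0..T}" "x \<in> \<O> - inner_part nrm \<O> r" for t x
    proof -
      have pos: "0 < V (t, x)" "0 < V (T, x)" using tx T V_pos by auto
      then have "0 \<le> \<bar>f (t, x, 0)\<bar> / V (t, x)" "0 \<le> \<bar>g x\<bar> / V (T, x)" by simp_all
      with le[OF tx] have "\<bar>f (t, x, 0)\<bar> / V (t, x) \<le> e" "\<bar>g x\<bar> / V (T, x) \<le> e" by linarith+
      with pos show ?thesis by (simp add: divide_le_eq)
    qed
    with sub compact_inner_part[OF N r(1)] show ?thesis by blast
  qed
  obtain \<delta> where \<delta>: "0 < \<delta>" "\<And>t x. t \<in> {0..T} \<Longrightarrow> x \<in> \<O> \<Longrightarrow> \<delta> \<le> V (t, x)"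
  proof -
    obtain K where "compact K" "K \<subseteq> \<O>" "\<forall>t\<in>{0..T}. \<forall>x\<in>\<O> - K. 1 \<le> V (t, x)"
      using coercive by blast
    then show thesis
      using coercive_imp_bounded_below[OF compact_Icc V_cont V_pos, of K] that by blast
  qed
  have X_in_probability: "(\<lambda>n. measure M {\<omega>\<in>space M.
      e \<le> dist (X (\<tau> n) (\<xi> n) (max s (\<tau> n)) \<omega>) (X t x (max s t) \<omega>)}) \<longlonglongrightarrow> 0"
    if e: "0 < e" and s: "s \<in> {0..T}" and t: "t \<in> {0..T}" and x: "x \<in> \<O>"
      and \<tau>: "\<And>n. \<tau> n \<in> {0..T}" and \<xi>: "\<And>n. \<xi> n \<in> \<O>" and lim: "\<tau> \<longlonglongrightarrow> t" "\<xi> \<longlonglongrightarrow> x"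
    for e s t x and \<tau> :: "nat \<Rightarrow> real" and \<xi> :: "nat \<Rightarrow> real ^ 'd"
  proof (rule in_probability_norm_imp_dist[OF prob N _ _ _ e])
    have meas: "X t x (max s t) \<in> borel_measurable M" if "t \<in> {0..T}" "x \<in> \<O>" for t x
      using measurable_joint_section[OF X_measurable[OF that], of "max s t"] s that
      by (simp add: measurable_restrict_space2_iff)
    show "X (\<tau> n) (\<xi> n) (max s (\<tau> n)) \<in> borel_measurable M" "X t x (max s t) \<in> borel_measurable M" for n
      using meas \<tau> \<xi> t x by blast+
    fix \<epsilon> :: real assume \<epsilon>: "0 < \<epsilon>"
    (* The hypothesis on X treats the entry with index 0 as the limit of the sequence. *)
    define \<tau>' \<xi>' where "\<tau>' = case_nat t \<tau>" and "\<xi>' = case_nat x \<xi>"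
    have \<tau>': "\<tau>' n \<in> {0..T}" and \<xi>': "\<xi>' n \<in> \<O>" for n
      using t x \<tau> \<xi> by (auto simp: \<tau>'_def \<xi>'_def split: nat.split)
    have "(\<lambda>n. N' (\<xi> n - x)) \<longlonglongrightarrow> N' 0" if "continuous_on UNIV N'" for N' :: "real ^ 'd \<Rightarrow> real"
      using tendsto_diff[OF lim(2) tendsto_const[of x]] by (intro continuous_on_tendsto_compose[OF that]) auto
    from this[OF is_norm_continuous_on[OF N]] have "(\<lambda>n. nrm (\<xi> n - x)) \<longlonglongrightarrow> nrm 0" .
    moreover have "nrm 0 = 0"
      using N unfolding is_norm_def by blast
    ultimately have "(\<lambda>n. nrm (\<xi> n - x)) \<longlonglongrightarrow> 0"
      by simp
    then have "(\<lambda>n. \<bar>\<tau> n - t\<bar> + nrm (\<xi> n - x)) \<longlonglongrightarrow> \<bar>t - t\<bar> + 0"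
      by (intro tendsto_intros lim)
    then have "(\<lambda>n. \<bar>\<tau>' (Suc n) - \<tau>' 0\<bar> + nrm (\<xi>' (Suc n) - \<xi>' 0)) \<longlonglongrightarrow> 0"
      by (simp add: \<tau>'_def \<xi>'_def)
    then have "(\<lambda>n. \<bar>\<tau>' n - \<tau>' 0\<bar> + nrm (\<xi>' n - \<xi>' 0)) \<longlonglongrightarrow> 0"
      by (rule LIMSEQ_imp_Suc)
    then have "(\<lambda>n. ereal (\<bar>\<tau>' n - \<tau>' 0\<bar> + nrm (\<xi>' n - \<xi>' 0))) \<longlonglongrightarrow> 0"
      by (simp add: zero_ereal_def)
    then have "limsup (\<lambda>n. ereal (\<bar>\<tau>' n - \<tau>' 0\<bar> + nrm (\<xi>' n - \<xi>' 0))) = 0"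
      by (intro lim_imp_Limsup) auto
    from X_continuous[OF \<epsilon> s \<tau>' \<xi>' this]
    have "limsup (\<lambda>n. ereal (measure M {\<omega>\<in>space M.
        \<epsilon> \<le> nrm (X (\<tau>' (n + 1)) (\<xi>' (n + 1)) (max s (\<tau>' (n + 1))) \<omega> - X (\<tau>' 0) (\<xi>' 0) (max s (\<tau>' 0)) \<omega>)})) = 0"
      by (subst limsup_shift)
    then show "limsup (\<lambda>n. ereal (measure M {\<omega>\<in>space M.
        \<epsilon> \<le> nrm (X (\<tau> n) (\<xi> n) (max s (\<tau> n)) \<omega> - X t x (max s t) \<omega>)})) = 0"
      by (simp add: \<tau>'_def \<xi>'_def)
  qed
  interpret controlled_process M T \<delta> \<O> X V
    by (intro controlled_process.intro controlled_process_axioms.intro;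
        rule prob X_measurable X_in_probability V_cont \<delta> V_supermartingale; assumption)
  have "continuous_on ({0..T} \<times> \<O>) (\<lambda>p. f (fst p, snd p, 0))"
    by (rule continuous_on_compose2[OF f_cont]) (auto intro!: continuous_intros)
  then have f0_cont: "continuous_on ({0..T} \<times> \<O>) (\<lambda>(t, x). f (t, x, 0))"
    by (simp add: split_beta)
  have f0: "sublinear (\<lambda>(t, x). f (t, x, 0))"
    unfolding sublinear_iff_vanishing[OF coercive f0_cont]
  proof (intro allI impI)
    fix e :: real assume e: "0 < e"
    from data[OF e] obtain K where "compact K" "K \<subseteq> \<O>"
      "\<forall>t\<in>{0..T}. \<forall>x\<in>\<O> - K. \<bar>f (t, x, 0)\<bar> \<le> e * V (t, x) \<and> \<bar>g x\<bar> \<le> e * V (T, x)"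
      by blast
    then show "\<exists>K. compact K \<and> K \<subseteq> \<O> \<and>
        (\<forall>t\<in>{0..T}. \<forall>x\<in>\<O> - K. \<bar>case (t, x) of (t, x) \<Rightarrow> f (t, x, 0)\<bar> \<le> e * V (t, x))"
      by (intro exI[of _ K]) simp
  qed
  have g_sub: "\<exists>C\<ge>0. \<forall>x\<in>\<O>. \<bar>g x\<bar> \<le> C + e * V (T, x)" if e: "0 < e" for e
  proof -
    from data[OF e] obtain K where K: "compact K" "K \<subseteq> \<O>"
      and gK: "\<forall>t\<in>{0..T}. \<forall>x\<in>\<O> - K. \<bar>f (t, x, 0)\<bar> \<le> e * V (t, x) \<and> \<bar>g x\<bar> \<le> e * V (T, x)"
      by blast
    have "continuous_on ({T} \<times> \<O>) (\<lambda>p. g (snd p))"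
      by (rule continuous_on_compose2[OF g_cont]) (auto intro!: continuous_intros)
    have "\<exists>C\<ge>0. \<forall>t\<in>{T}. \<forall>x\<in>\<O>. \<bar>g (snd (t, x))\<bar> \<le> C + e * V (t, x)"
      by (rule bounded_off_compact[OF _ K \<open>continuous_on ({T} \<times> \<O>) (\<lambda>p. g (snd p))\<close>])
        (use bspec[OF gK, of T] e V_pos[of T] T in \<open>auto intro: less_imp_le\<close>)
    then show ?thesis by simp
  qed
  interpret semilinear_problem M T \<delta> \<O> X V L f g
    using L T f_cont f_Lipschitz f0 g_cont g_sub
    by unfold_locales (assumption | rule less_imp_le)+
  have iff: "continuous_on ({0..T} \<times> \<O>) u \<and>
      Limsup at_top (\<lambda>r::real. SUP t\<in>{0..T}. SUP x\<in>\<O> - inner_part nrm \<O> r.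
        ereal (\<bar>u (t, x)\<bar> / V (t, x))) = 0 \<and> solves_sfpe M T \<O> X f g u
    \<longleftrightarrow> admissible u \<and> (\<forall>t\<in>{0..T}. \<forall>x\<in>\<O>. u (t, x) = picard u (t, x))" for u
  proof -
    have "Limsup at_top (\<lambda>r::real. SUP t\<in>{0..T}. SUP x\<in>\<O> - inner_part nrm \<O> r.
        ereal (\<bar>u (t, x)\<bar> / V (t, x))) = 0 \<longleftrightarrow> sublinear u"
      if "continuous_on ({0..T} \<times> \<O>) u"
      unfolding sublinear_iff_vanishing[OF coercive that]
      by (rule Limsup_inner_part_eq_0_iff[where V = V and T = T, OF N S(2,1) less_imp_le[OF T] V_pos])
    then show ?thesis
      using solves_sfpe_iff_picard unfolding admissible_def by blast
  qed
  obtain u where u: "u \<in> extensional ({0..T} \<times> \<O>)" "admissible u"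
    "\<And>t x. t \<in> {0..T} \<Longrightarrow> x \<in> \<O> \<Longrightarrow> u (t, x) = picard u (t, x)"
    using picard_fixed_point_exists by blast
  show ?thesis
    unfolding iff
  proof (rule ex1I[of _ u])
    fix v assume v: "v \<in> extensional ({0..T} \<times> \<O>) \<and> admissible v \<and>
      (\<forall>t\<in>{0..T}. \<forall>x\<in>\<O>. v (t, x) = picard v (t, x))"
    show "v = u"
    proof (rule extensionalityI)
      fix p assume "p \<in> {0..T} \<times> \<O>"
      then show "v p = u p"
        using picard_fixed_point_unique[of v u "fst p" "snd p"] u v by (auto simp: mem_Times_iff)
    qed (use u v in auto)
  qed (use u in auto)
qed

end
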